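(* Let $f(x,y)=f_1x+f_2y$ and $g(x,y)=g_1x+g_2y$ be nonzero linear functions with $f_1,f_2,g_1,g_2\in\mathbb{Z}$, let $b$ be a positive integer, and let $S=\{v\in\mathbb{N}^2\mid f(v)\bmod b\le g(v)\}$. Assume that $g_1g_2\le 0$, that $g_1$ and $g_2$ are not both $\le 0$, and that $S\ne\mathbb{N}^2$. Then $S$ is Buchsbaum.
   Context: $\mathbb{N}$ is the set of non-negative integers; for an integer $a$ and a positive integer $b$, $a\bmod b\in\{0,\dots,b-1\}$ is the remainder of the Euclidean division of $a$ by $b$. The set $S$ is a finitely generated submonoid of $\mathbb{N}^2$. For a field $\mathbf{k}$, $\mathbf{k}[S]=\bigoplus_{m\in S}\mathbf{k}\chi^m$ is the semigroup ring with $\mathbf{k}$-linear multiplication determined by $\chi^m\cdot\chi^n=\chi^{m+n}$. A Noetherian $R$-module $M$ is a Buchsbaum module if every system of parameters of $M$ is a weak $M$-sequence, and $R$ is a Buchsbaum ring if it is a Buchsbaum module over itself. $S$ is called Buchsbaum if $\mathbf{k}[S]$ is a Buchsbaum ring. *)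

theory Defs
  imports
    "HOL-Algebra.Module"
    "HOL-Algebra.Ideal"
    "HOL-Algebra.Ring_Divisibility"
    "HOL-Library.Extended_Nat"
    "HOL-Library.Poly_Mapping"
    "HOL-Library.Product_Plus"
begin

section \<open>Localization of a commutative ring at a prime ideal\<close>

definition loc_rel :: "('a, 'b) ring_scheme \<Rightarrow> 'a set \<Rightarrow> (('a \<times> 'a) \<times> ('a \<times> 'a)) set" where
  "loc_rel R P = {((a, s), (b, t)).
     a \<in> carrier R \<and> b \<in> carrier R \<and> s \<in> carrier R - P \<and> t \<in> carrier R - P \<and>
     (\<exists>u \<in> carrier R - P. u \<otimes>\<^bsub>R\<^esub> (a \<otimes>\<^bsub>R\<^esub> t \<ominus>\<^bsub>R\<^esub> b \<otimes>\<^bsub>R\<^esub> s) = \<zero>\<^bsub>R\<^esub>)}"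

definition loc_frac :: "('a, 'b) ring_scheme \<Rightarrow> 'a set \<Rightarrow> 'a \<Rightarrow> 'a \<Rightarrow> ('a \<times> 'a) set" where
  "loc_frac R P a s = loc_rel R P `` {(a, s)}"

text \<open>The operations take unions over all representatives. When \<open>P\<close> is prime, the sets in such a
  union are all the same class.\<close>

definition localization :: "('a, 'b) ring_scheme \<Rightarrow> 'a set \<Rightarrow> ('a \<times> 'a) set ring" where
  "localization R P = \<lparr>
     carrier = (carrier R \<times> (carrier R - P)) // loc_rel R P,
     mult = (\<lambda>X Y. \<Union>(a, s)\<in>X. \<Union>(b, t)\<in>Y. loc_frac R P (a \<otimes>\<^bsub>R\<^esub> b) (s \<otimes>\<^bsub>R\<^esub> t)),
     one = loc_frac R P \<one>\<^bsub>R\<^esub> \<one>\<^bsub>R\<^esub>,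
     zero = loc_frac R P \<zero>\<^bsub>R\<^esub> \<one>\<^bsub>R\<^esub>,
     add = (\<lambda>X Y. \<Union>(a, s)\<in>X. \<Union>(b, t)\<in>Y.
              loc_frac R P (a \<otimes>\<^bsub>R\<^esub> t \<oplus>\<^bsub>R\<^esub> b \<otimes>\<^bsub>R\<^esub> s) (s \<otimes>\<^bsub>R\<^esub> t))\<rparr>"


section \<open>Noetherian modules, dimension and length\<close>

definition ring_as_module :: "('a, 'b) ring_scheme \<Rightarrow> ('a, 'a) module" where
  "ring_as_module R = \<lparr>carrier = carrier R, mult = mult R, one = one R, zero = zero R,
     add = add R, smult = mult R\<rparr>"

definition submodule_span ::
  "('a, 'b) ring_scheme \<Rightarrow> ('a, 'm, 'c) module_scheme \<Rightarrow> 'm set \<Rightarrow> 'm set" where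
  "submodule_span R M A = \<Inter>{N. submodule N R M \<and> A \<subseteq> N}"

definition noetherian_module ::
  "('a, 'b) ring_scheme \<Rightarrow> ('a, 'm, 'c) module_scheme \<Rightarrow> bool" where
  "noetherian_module R M \<longleftrightarrow> module R M \<and>
     (\<forall>N. submodule N R M \<longrightarrow> (\<exists>A \<subseteq> carrier M. finite A \<and> N = submodule_span R M A))"

definition annihilator :: "('a, 'b) ring_scheme \<Rightarrow> ('a, 'm, 'c) module_scheme \<Rightarrow> 'a set" where
  "annihilator R M = {r \<in> carrier R. \<forall>v \<in> carrier M. r \<odot>\<^bsub>M\<^esub> v = \<zero>\<^bsub>M\<^esub>}"

text \<open>Supremum of the numbers \<open>n\<close> of strict inclusions in chains \<open>C 0 \<subset> \<dots> \<subset> C n\<close>.\<close>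

definition chain_length_sup :: "'a set set \<Rightarrow> enat" where
  "chain_length_sup F =
     Sup {enat n | n. \<exists>C. (\<forall>i\<le>n. C i \<in> F) \<and> (\<forall>i<n. C i \<subset> C (Suc i))}"

text \<open>The primes of \<open>R / Ann M\<close> are the primes of \<open>R\<close> containing \<open>Ann M\<close>, so this is the Krull
  dimension of \<open>R / Ann M\<close>.\<close>

definition module_dim :: "('a, 'b) ring_scheme \<Rightarrow> ('a, 'm, 'c) module_scheme \<Rightarrow> enat" where
  "module_dim R M = chain_length_sup {P. primeideal P R \<and> annihilator R M \<subseteq> P}"

text \<open>The length of \<open>M / N\<close>, via the submodules of \<open>M\<close> containing \<open>N\<close>.\<close>

definition quotient_length ::
  "('a, 'b) ring_scheme \<Rightarrow> ('a, 'm, 'c) module_scheme \<Rightarrow> 'm set \<Rightarrow> enat" where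
  "quotient_length R M N = chain_length_sup {L. submodule L R M \<and> N \<subseteq> L}"


section \<open>Buchsbaum modules and rings\<close>

definition noetherian_local_ring :: "('a, 'b) ring_scheme \<Rightarrow> 'a set \<Rightarrow> bool" where
  "noetherian_local_ring R \<mm> \<longleftrightarrow> cring R \<and> noetherian_ring R \<and>
     maximalideal \<mm> R \<and> (\<forall>\<nn>. maximalideal \<nn> R \<longrightarrow> \<nn> = \<mm>)"

text \<open>The submodule \<open>(x\<^sub>1, \<dots>, x\<^sub>n) M\<close>.\<close>

definition ideal_mult ::
  "('a, 'b) ring_scheme \<Rightarrow> ('a, 'm, 'c) module_scheme \<Rightarrow> 'a list \<Rightarrow> 'm set" where
  "ideal_mult R M xs = submodule_span R M {x \<odot>\<^bsub>M\<^esub> v | x v. x \<in> set xs \<and> v \<in> carrier M}"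

definition system_of_parameters ::
  "('a, 'b) ring_scheme \<Rightarrow> 'a set \<Rightarrow> ('a, 'm, 'c) module_scheme \<Rightarrow> 'a list \<Rightarrow> bool" where
  "system_of_parameters R \<mm> M xs \<longleftrightarrow> set xs \<subseteq> \<mm> \<and> enat (length xs) = module_dim R M \<and>
     quotient_length R M (ideal_mult R M xs) < \<infinity>"

text \<open>\<open>\<mm> \<cdot> ((x\<^sub>1, \<dots>, x\<^sub>i\<^sub>-\<^sub>1) M : x\<^sub>i) \<subseteq> (x\<^sub>1, \<dots>, x\<^sub>i\<^sub>-\<^sub>1) M\<close> for every \<open>i\<close>; list positions start at \<open>0\<close>.\<close>

definition weak_sequence ::
  "('a, 'b) ring_scheme \<Rightarrow> 'a set \<Rightarrow> ('a, 'm, 'c) module_scheme \<Rightarrow> 'a list \<Rightarrow> bool" where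
  "weak_sequence R \<mm> M xs \<longleftrightarrow>
     (\<forall>i < length xs. \<forall>v \<in> carrier M. xs ! i \<odot>\<^bsub>M\<^esub> v \<in> ideal_mult R M (take i xs) \<longrightarrow>
        (\<forall>r \<in> \<mm>. r \<odot>\<^bsub>M\<^esub> v \<in> ideal_mult R M (take i xs)))"

definition buchsbaum_module ::
  "('a, 'b) ring_scheme \<Rightarrow> ('a, 'm, 'c) module_scheme \<Rightarrow> bool" where
  "buchsbaum_module R M \<longleftrightarrow>
     (\<exists>\<mm>. noetherian_local_ring R \<mm> \<and> noetherian_module R M \<and>
        (\<forall>xs. system_of_parameters R \<mm> M xs \<longrightarrow> weak_sequence R \<mm> M xs))"

text \<open>Systems of parameters and weak sequences refer to a local ring. A Noetherian ring that need
  not be local is Buchsbaum if its localizations at all maximal ideals are Buchsbaum modules over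
  themselves. For a local ring \<open>R\<close> this adds nothing, since \<open>R\<close> is then canonically isomorphic to
  its localization at the maximal ideal.\<close>

definition buchsbaum_ring :: "('a, 'b) ring_scheme \<Rightarrow> bool" where
  "buchsbaum_ring R \<longleftrightarrow> cring R \<and> noetherian_ring R \<and>
     (\<forall>\<mm>. maximalideal \<mm> R \<longrightarrow>
        buchsbaum_module (localization R \<mm>) (ring_as_module (localization R \<mm>)))"


section \<open>Semigroup rings\<close>

text \<open>Multiplication of finitely supported functions is convolution, so
  \<open>\<chi>\<^sup>m\<close> is \<open>Poly_Mapping.single m 1\<close>.\<close>

definition semigroup_ring :: "'a::comm_monoid_add set \<Rightarrow> ('a \<Rightarrow>\<^sub>0 'k::comm_ring_1) ring" where
  "semigroup_ring S = \<lparr>carrier = {p. Poly_Mapping.keys p \<subseteq> S},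
     mult = (*), one = 1, zero = 0, add = (+)\<rparr>"

definition buchsbaum_semigroup :: "'k::field itself \<Rightarrow> (nat \<times> nat) set \<Rightarrow> bool" where
  "buchsbaum_semigroup _ S \<longleftrightarrow>
     buchsbaum_ring (semigroup_ring S :: ((nat \<times> nat) \<Rightarrow>\<^sub>0 'k) ring)"

end

theory Submission
  imports Defs "HOL-Library.Product_Lexorder"
begin

text \<open>
  The ring \<open>\<k>[S]\<close> is even Cohen-Macaulay. Suppose \<open>g1 > 0 \<ge> g2\<close>; the other case is its mirror image.
  Then \<open>S\<close> contains \<open>e1 = (b, 0)\<close> and \<open>e2 = (- g2 b, g1 b)\<close>, vectors on the two edges of the
  cone \<open>g \<ge> 0\<close>. Adding either of them does not change \<open>f\<close> modulo \<open>b\<close>, and \<open>g e2 = 0\<close>. So if an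
  integer vector \<open>t\<close> becomes an element of \<open>S\<close> after adding a multiple of \<open>e1\<close> and also after
  adding a multiple of \<open>e2\<close>, then the second membership gives \<open>f t mod b \<le> g t\<close>, in particular
  \<open>g t \<ge> 0\<close>. The second coordinate of \<open>t\<close> is nonnegative because \<open>e1\<close> does not touch it, and by the
  signs of \<open>g1\<close> and \<open>g2\<close> so is the first. Hence \<open>t \<in> S\<close>. The proof rests on this separation property
  and on finiteness of \<open>S\<close> over the monoid generated by \<open>e1\<close> and \<open>e2\<close> (\<open>modular_monoid_cm\<close>).

  Separation makes every pair consisting of a nonzero polynomial in \<open>X = \<chi>\<^sup>e\<^sup>1\<close> and a nonzero
  polynomial in \<open>Y = \<chi>\<^sup>e\<^sup>2\<close> a regular sequence on \<open>\<k>[S]\<close> (\<open>axis_polynomials_regular\<close>), by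
  division with remainder with respect to leading exponents in the lexicographic order. The same
  leading exponents, with Dickson's lemma, show that \<open>\<k>[S]\<close> is Noetherian (\<open>R_noetherian\<close>).

  Dimension theory enters only through one counting argument: there are \<open>N\<^sup>3\<close> monomials of degree
  less than \<open>N\<close> in each of three given elements, but their exponents lie in a square with
  \<open>O(N\<^sup>2)\<close> points, so any three elements are algebraically dependent
  (\<open>three_algebraically_dependent\<close>). Reading off the lowest coefficient of such a relation along a
  chain of primes \<open>P0 \<subset> P1 \<subset> P2\<close> shows that every element \<open>z\<close> satisfies a nonzero polynomial over
  the field modulo \<open>P2\<close> (\<open>relation_in_third_prime\<close>). Taking \<open>z\<close> outside \<open>P2\<close> in a fourth prime
  shows that the dimension is at most two; taking \<open>z = X\<close> and \<open>z = Y\<close> shows that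
  the regular sequence above can be chosen inside any maximal ideal that contains such a chain.

  It remains to look at a local domain \<open>A\<close> of dimension at most two
  (\<open>buchsbaum_of_regular_pair\<close>). If \<open>A\<close> has dimension two and \<open>x, y\<close> is a system of parameters,
  powers \<open>p, q\<close> of a regular sequence lie in \<open>(x, y)\<close>. If \<open>y v \<in> (x)\<close>, then \<open>p v = x c\<close> and
  \<open>q v = x d\<close>, so \<open>q c = p d\<close>, regularity gives \<open>p\<close> divides \<open>c\<close>, and \<open>v \<in> (x)\<close> follows. A
  similar computation excludes \<open>x = 0\<close>. Thus every system of parameters is a regular sequence.
\<close>

section \<open>Leading exponents\<close>

text \<open>
  The lexicographic order is compatible with addition. This makes it a monomial order on \<open>\<nat>\<^sup>2\<close>, and
  finitely supported functions on a monoid with such an order form an integral domain.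
\<close>
instance prod :: (ordered_cancel_comm_monoid_add, ordered_cancel_comm_monoid_add) ordered_cancel_comm_monoid_add
proof
  fix a b c :: "'a \<times> 'b"
  assume "a \<le> b"
  then show "c + a \<le> c + b"
    by (cases a; cases b; cases c) (auto simp: less_eq_prod_def intro: add_strict_left_mono add_left_mono)
qed

abbreviation keys :: "('a \<Rightarrow>\<^sub>0 'k::zero) \<Rightarrow> 'a set" where
  "keys \<equiv> Poly_Mapping.keys"

abbreviation lookup :: "('a \<Rightarrow>\<^sub>0 'k::zero) \<Rightarrow> 'a \<Rightarrow> 'k" where
  "lookup \<equiv> Poly_Mapping.lookup"

abbreviation mon :: "'a \<Rightarrow> 'k \<Rightarrow> ('a \<Rightarrow>\<^sub>0 'k::zero)" where
  "mon \<equiv> Poly_Mapping.single"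

definition lead_exp :: "('a::linorder \<Rightarrow>\<^sub>0 'k::zero) \<Rightarrow> 'a" where
  "lead_exp p = Max (keys p)"

abbreviation lead_coeff_of :: "('a::linorder \<Rightarrow>\<^sub>0 'k::zero) \<Rightarrow> 'k" where
  "lead_coeff_of p \<equiv> lookup p (lead_exp p)"

lemma keys_le_lead_exp: "u \<in> keys p \<Longrightarrow> u \<le> lead_exp p"
  by (simp add: lead_exp_def)

lemma lead_exp_in_keys: "p \<noteq> 0 \<Longrightarrow> lead_exp p \<in> keys p"
  unfolding lead_exp_def by (rule Max_in) (auto simp: poly_mapping_eq_iff in_keys_iff fun_eq_iff)

lemma poly_mapping_expand:
  "p = (\<Sum>v\<in>keys p. mon v (lookup p v))"
  by (rule poly_mapping_eqI) (auto simp: lookup_sum lookup_single when_def in_keys_iff)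

lemma lookup_mult_keys:
  "lookup (p * q) w = (\<Sum>u\<in>keys p. \<Sum>v\<in>keys q. (lookup p u * lookup q v when u + v = w))"
proof -
  have "p * q = (\<Sum>u\<in>keys p. \<Sum>v\<in>keys q. mon (u + v) (lookup p u * lookup q v))"
    by (subst poly_mapping_expand[of p], subst poly_mapping_expand[of q])
       (simp add: sum_product mult_single)
  then show ?thesis by (simp add: lookup_sum lookup_single)
qed

lemma add_eq_lead_imp:
  fixes u v a b :: "'a::{ordered_cancel_comm_monoid_add, linorder}"
  assumes "u \<le> a" "v \<le> b" "u + v = a + b"
  shows "u = a \<and> v = b"
  using assms by (metis add_le_less_mono add_less_le_mono order.not_eq_order_implies_strict order_less_irrefl)

text \<open>
  Leading terms cannot cancel: the sum of the two leading exponents arises from one pair of exponents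
  only.
\<close>
lemma lead_exp_add_in_keys_mult:
  fixes p q :: "'a::{ordered_cancel_comm_monoid_add, linorder} \<Rightarrow>\<^sub>0 'k::idom"
  assumes "p \<noteq> 0" "q \<noteq> 0"
  shows "lead_exp p + lead_exp q \<in> keys (p * q)"
proof -
  have "lookup (p * q) (lead_exp p + lead_exp q)
    = (\<Sum>u\<in>keys p. if u = lead_exp p then (\<Sum>v\<in>keys q. if v = lead_exp q then lead_coeff_of p * lead_coeff_of q else 0) else 0)"
    unfolding lookup_mult_keys
  proof (intro sum.cong refl)
    fix u assume u: "u \<in> keys p"
    have "(lookup p u * lookup q v when u + v = lead_exp p + lead_exp q) =
      (if u = lead_exp p \<and> v = lead_exp q then lead_coeff_of p * lead_coeff_of q else 0)"
      if "v \<in> keys q" for v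
      using add_eq_lead_imp[of u "lead_exp p" v "lead_exp q"] u that
      by (auto simp: when_def keys_le_lead_exp)
    then show "(\<Sum>v\<in>keys q. (lookup p u * lookup q v when u + v = lead_exp p + lead_exp q)) =
      (if u = lead_exp p then (\<Sum>v\<in>keys q. if v = lead_exp q then lead_coeff_of p * lead_coeff_of q else 0) else 0)"
      by (auto intro!: sum.cong sum.neutral)
  qed
  also have "\<dots> = lead_coeff_of p * lead_coeff_of q"
    using assms by (simp add: lead_exp_in_keys)
  also have "\<dots> \<noteq> 0"
    using assms lead_exp_in_keys by (auto simp: in_keys_iff)
  finally show ?thesis by (simp add: in_keys_iff)
qed

text \<open>
  Well-founded induction for reduction arguments. In the step, \<open>a'\<close> may be zero, whose leading exponent
  is meaningless; therefore smallness is expressed by bounding all exponents of \<open>a'\<close>.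
\<close>
lemma lead_exp_induct:
  fixes P :: "('a::wellorder \<Rightarrow>\<^sub>0 'k::zero) \<Rightarrow> bool"
  assumes step: "\<And>a. (\<And>a'. a \<noteq> 0 \<Longrightarrow> \<forall>u\<in>keys a'. u < lead_exp a \<Longrightarrow> P a') \<Longrightarrow> P a"
  shows "P a"
proof (cases "a = 0")
  case True
  then show ?thesis using step by blast
next
  case False
  then show ?thesis
  proof (induction "lead_exp a" arbitrary: a rule: less_induct)
    case less
    have "P 0" by (rule step) simp
    show ?case
    proof (rule step)
      fix a' :: "'a \<Rightarrow>\<^sub>0 'k" assume *: "\<forall>u\<in>keys a'. u < lead_exp a"
      show "P a'"
        using less.hyps[of a'] * lead_exp_in_keys \<open>P 0\<close> by (cases "a' = 0") auto
    qed
  qed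
qed

lemma lookup_mon_mult:
  fixes p :: "'a::{comm_monoid_add, cancel_ab_semigroup_add} \<Rightarrow>\<^sub>0 'k::comm_semiring_1"
  shows "lookup (mon w c * p) (w + u) = c * lookup p u"
proof (cases "c = 0")
  case False
  have "lookup (mon w c * p) (w + u) = (\<Sum>v\<in>keys p. if v = u then c * lookup p v else 0)"
    using False unfolding lookup_mult_keys by (auto simp: when_def intro!: sum.cong)
  then show ?thesis by (auto simp: in_keys_iff)
qed simp

lemma keys_reduce_lead:
  fixes a p :: "'a::{ordered_cancel_comm_monoid_add, linorder} \<Rightarrow>\<^sub>0 'k::field"
  assumes "p \<noteq> 0" and lead: "lead_exp a = w + lead_exp p"
  shows "\<forall>u\<in>keys (a - mon w (lead_coeff_of a / lead_coeff_of p) * p). u < lead_exp a"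
proof
  fix u assume u: "u \<in> keys (a - mon w (lead_coeff_of a / lead_coeff_of p) * p)"
  let ?m = "mon w (lead_coeff_of a / lead_coeff_of p)"
  have "lookup (a - ?m * p) (lead_exp a) = 0"
    using assms lead_exp_in_keys[of p] by (simp add: lookup_minus lead lookup_mon_mult in_keys_iff)
  then have "u \<noteq> lead_exp a" using u by (auto simp: in_keys_iff)
  moreover have "u \<le> lead_exp a"
  proof -
    have "u \<in> keys a \<or> u \<in> keys (?m * p)"
      using u by (auto simp: in_keys_iff lookup_minus)
    moreover have "keys (?m * p) \<subseteq> {w + v | v. v \<in> keys p}"
      using keys_mult[of ?m p] by (auto split: if_splits)
    moreover have "w + v \<le> lead_exp a" if "v \<in> keys p" for v
      unfolding lead by (rule add_left_mono) (rule keys_le_lead_exp[OF that])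
    ultimately show ?thesis
      using keys_le_lead_exp[of u a] by blast
  qed
  ultimately show "u < lead_exp a" by simp
qed

section \<open>Algebraic dependence of three elements\<close>

text \<open>Scalars act through the constants \<open>c \<chi>\<^sup>0\<close>, which keeps scaling inside the ring multiplication.\<close>
lemma vector_space_poly_mapping:
  "vector_space (\<lambda>c (p :: 'a::comm_monoid_add \<Rightarrow>\<^sub>0 'k::field). mon 0 c * p)"
  by standard (simp_all add: algebra_simps single_add mult_single mult.assoc[symmetric])

text \<open>
  More vectors than available exponents are linearly dependent. The vectors form a family rather than
  a set, so that repetitions count as relations.
\<close>
lemma nontrivial_relation:
  fixes w :: "'i \<Rightarrow> ('a::comm_monoid_add \<Rightarrow>\<^sub>0 'k::field)"
  assumes "finite I" "finite B" and keys: "\<And>i. i \<in> I \<Longrightarrow> keys (w i) \<subseteq> B"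
    and card: "card B < card I"
  shows "\<exists>c. (\<exists>i\<in>I. c i \<noteq> 0) \<and> (\<Sum>i\<in>I. mon 0 (c i) * w i) = 0"
proof -
  interpret vs: vector_space "\<lambda>c (p :: 'a \<Rightarrow>\<^sub>0 'k). mon 0 c * p"
    by (rule vector_space_poly_mapping)
  show ?thesis
  proof (cases "inj_on w I")
    case True
    have "w ` I \<subseteq> vs.span ((\<lambda>v. mon v 1) ` B)"
    proof safe
      fix i assume i: "i \<in> I"
      have "(\<Sum>v\<in>keys (w i). mon 0 (lookup (w i) v) * mon v 1) \<in> vs.span ((\<lambda>v. mon v 1) ` B)"
        using keys[OF i] by (intro vs.span_sum vs.span_scale vs.span_base) auto
      then show "w i \<in> vs.span ((\<lambda>v. mon v 1) ` B)"
        using poly_mapping_expand[of "w i"] by (simp add: mult_single)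
    qed
    moreover have "card ((\<lambda>v. mon v (1::'k)) ` B) < card (w ` I)"
      using card card_image_le[OF \<open>finite B\<close>, of "\<lambda>v. mon v (1::'k)"] card_image[OF True] by linarith
    ultimately have "vs.dependent (w ` I)"
      using vs.independent_span_bound[of "(\<lambda>v. mon v 1) ` B" "w ` I"] \<open>finite B\<close> by fastforce
    then obtain c where c: "\<exists>v\<in>w ` I. c v \<noteq> 0" "(\<Sum>v\<in>w ` I. mon 0 (c v) * v) = 0"
      using vs.dependent_finite[of "w ` I"] \<open>finite I\<close> by auto
    then show ?thesis
      using sum.reindex[OF True, of "\<lambda>v. mon 0 (c v) * v"]
      by (intro exI[of _ "c \<circ> w"]) auto
  next
    case False
    then obtain i j where ij: "i \<in> I" "j \<in> I" "i \<noteq> j" "w i = w j" by (auto simp: inj_on_def)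
    define c :: "'i \<Rightarrow> 'k" where "c = (\<lambda>l. if l = i then 1 else if l = j then -1 else 0)"
    have "(\<Sum>l\<in>I. mon 0 (c l) * w l) = (\<Sum>l\<in>{i, j}. mon 0 (c l) * w l)"
      by (rule sum.mono_neutral_right) (use \<open>finite I\<close> ij in \<open>auto simp: c_def\<close>)
    also have "\<dots> = 0" using ij by (simp add: c_def single_uminus)
    finally show ?thesis using ij by (intro exI[of _ c]) (auto simp: c_def)
  qed
qed

lemma keys_prod_box:
  fixes p q :: "nat \<times> nat \<Rightarrow>\<^sub>0 'k::comm_semiring_1"
  assumes "keys p \<subseteq> {..m} \<times> {..m}" "keys q \<subseteq> {..n} \<times> {..n}"
  shows "keys (p * q) \<subseteq> {..m + n} \<times> {..m + n}"
proof
  fix w assume "w \<in> keys (p * q)"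
  then obtain u v where "w = u + v" "u \<in> keys p" "v \<in> keys q" using keys_mult[of p q] by blast
  then show "w \<in> {..m + n} \<times> {..m + n}"
    using assms by (cases u; cases v) fastforce
qed

lemma keys_power_box:
  fixes p :: "nat \<times> nat \<Rightarrow>\<^sub>0 'k::comm_semiring_1"
  assumes "keys p \<subseteq> {..m} \<times> {..m}"
  shows "keys (p ^ n) \<subseteq> {..n * m} \<times> {..n * m}"
proof (induction n)
  case (Suc n)
  then show ?case using keys_prod_box[OF assms Suc.IH] by simp
qed (auto simp: keys_one zero_prod_def)

lemma keys_in_box:
  fixes p :: "nat \<times> nat \<Rightarrow>\<^sub>0 'k::zero"
  shows "\<exists>m. keys p \<subseteq> {..m} \<times> {..m}"
proof -
  have "finite (fst ` keys p \<union> snd ` keys p)" by simp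
  then obtain m where "fst ` keys p \<union> snd ` keys p \<subseteq> {..m}"
    by (meson finite_nat_iff_bounded_le)
  then show ?thesis by (intro exI[of _ m]) force
qed

text \<open>
  The transcendence degree is at most two because the \<open>N\<^sup>3\<close> monomials in \<open>x, y, z\<close> with exponents
  below \<open>N\<close> involve at most \<open>(N D + 1)\<^sup>2\<close> exponent vectors, for a constant \<open>D\<close>. The relation is
  grouped as a polynomial in \<open>x\<close> whose coefficients are polynomials in \<open>y\<close>, because its coefficients
  are read off one variable at a time.
\<close>
lemma three_algebraically_dependent:
  fixes x y z :: "nat \<times> nat \<Rightarrow>\<^sub>0 'k::field"
  obtains N c where "\<exists>i<N. \<exists>j<N. \<exists>l<N. c i j l \<noteq> 0"
    "(\<Sum>i<N. (\<Sum>j<N. (\<Sum>l<N. mon 0 (c i j l) * z ^ l) * y ^ j) * x ^ i) = 0"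
proof -
  obtain mx my mz where m: "keys x \<subseteq> {..mx} \<times> {..mx}" "keys y \<subseteq> {..my} \<times> {..my}" "keys z \<subseteq> {..mz} \<times> {..mz}"
    using keys_in_box[of x] keys_in_box[of y] keys_in_box[of z] by blast
  define D where "D = mx + my + mz"
  \<comment> \<open>Any \<open>N > (D + 1)\<^sup>2\<close> makes \<open>(N D + 1)\<^sup>2 \<le> N\<^sup>2 (D + 1)\<^sup>2 < N\<^sup>3\<close>.\<close>
  define N where "N = 2 * (D + 1)^2"
  define I where "I = {..<N} \<times> {..<N} \<times> {..<N}"
  define B where "B = {..N * D} \<times> {..N * D}"
  define w where "w = (\<lambda>(i, j, l). z ^ l * y ^ j * x ^ i)"
  have keys: "keys (w t) \<subseteq> B" if "t \<in> I" for t
  proof -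
    obtain i j l where t: "t = (i, j, l)" by (cases t)
    have "keys (w t) \<subseteq> {..l * mz + j * my + i * mx} \<times> {..l * mz + j * my + i * mx}"
      unfolding w_def t prod.case by (intro keys_prod_box keys_power_box m)
    moreover have "l * mz + j * my + i * mx \<le> N * mz + N * my + N * mx"
      using that unfolding t I_def by (intro add_mono mult_le_mono1) auto
    then have "l * mz + j * my + i * mx \<le> N * D" by (simp add: D_def algebra_simps)
    ultimately show ?thesis by (force simp: B_def)
  qed
  have "card B < card I"
  proof -
    have N: "N \<ge> 1" by (simp add: N_def)
    have "card B = (N * D + 1)^2" by (simp add: B_def power2_eq_square)
    also have "\<dots> \<le> (N * (D + 1))^2" using N by (intro power_mono) simp_all
    also have "\<dots> = N^2 * (D + 1)^2" by (simp only: power_mult_distrib)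
    also have "\<dots> < N^2 * N" using N by (simp add: N_def)
    also have "\<dots> = card I" by (simp add: I_def power2_eq_square)
    finally show ?thesis .
  qed
  then obtain c where c: "\<exists>t\<in>I. c t \<noteq> 0" "(\<Sum>t\<in>I. mon 0 (c t) * w t) = 0"
    using nontrivial_relation[of I B w] keys by (auto simp: I_def B_def)
  have "(\<Sum>i<N. (\<Sum>j<N. (\<Sum>l<N. mon 0 (c (i, j, l)) * z ^ l) * y ^ j) * x ^ i) = (\<Sum>t\<in>I. mon 0 (c t) * w t)"
    unfolding I_def w_def
    by (simp add: sum.cartesian_product[symmetric] sum_distrib_right mult.assoc split_def)
       (simp add: sum.cartesian_product split_def)
  then show thesis
    using c by (intro that[of N "\<lambda>i j l. c (i, j, l)"]) (auto simp: I_def)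
qed

section \<open>Semigroup rings of plane monoids and their primes\<close>

lemma keys_plus_subset: "keys p \<subseteq> S \<Longrightarrow> keys q \<subseteq> S \<Longrightarrow> keys (p + q) \<subseteq> S"
  using Poly_Mapping.keys_add[of p q] by blast

lemma keys_minus_subset:
  fixes p q :: "'a \<Rightarrow>\<^sub>0 'k::ab_group_add"
  shows "keys p \<subseteq> S \<Longrightarrow> keys q \<subseteq> S \<Longrightarrow> keys (p - q) \<subseteq> S"
  using Poly_Mapping.keys_add[of p "- q"] by auto

lemma keys_times_subset:
  assumes "keys p \<subseteq> S" "keys q \<subseteq> S" "\<And>u v. u \<in> S \<Longrightarrow> v \<in> S \<Longrightarrow> u + v \<in> S"
  shows "keys (p * q) \<subseteq> S"
  using keys_mult[of p q] assms by blast

lemma keys_power_subset: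
  fixes p :: "'a::monoid_add \<Rightarrow>\<^sub>0 'k::semiring_1"
  assumes "keys p \<subseteq> S" "0 \<in> S" "\<And>u v. u \<in> S \<Longrightarrow> v \<in> S \<Longrightarrow> u + v \<in> S"
  shows "keys (p ^ n) \<subseteq> S"
proof (induction n)
  case 0
  then show ?case using assms(2) Poly_Mapping.keys_one[where ?'a = 'a and ?'b = 'k] by simp
next
  case (Suc n)
  then show ?case using keys_times_subset[OF assms(1) Suc.IH assms(3)] by simp
qed

lemma keys_mon_subset: "v \<in> S \<Longrightarrow> keys (mon v c) \<subseteq> S"
  by simp

lemma keys_sum_subset:
  assumes "\<And>i. i \<in> I \<Longrightarrow> keys (h i) \<subseteq> S"
  shows "keys (sum h I) \<subseteq> S"
  using assms by (induction I rule: infinite_finite_induct) (simp_all add: keys_plus_subset)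

text \<open>
  The ring is a parameter of the locale, tied to \<open>S\<close> by an equation, in order to fix the coefficient
  field.
\<close>
locale plane_monoid =
  fixes S :: "(nat \<times> nat) set" and R :: "((nat \<times> nat) \<Rightarrow>\<^sub>0 'k::field) ring" (structure)
  assumes zero_in: "0 \<in> S"
    and add_in: "u \<in> S \<Longrightarrow> v \<in> S \<Longrightarrow> u + v \<in> S"
    and R_def: "R = semigroup_ring S"
begin

lemma R_simps [simp]:
  "a \<in> carrier R \<longleftrightarrow> keys a \<subseteq> S"
  "a \<otimes> a' = a * a'" "a \<oplus> a' = a + a'" "\<zero> = 0" "\<one> = 1"
  by (simp_all add: R_def semigroup_ring_def)

lemma keys_one_in: "keys (1 :: (nat \<times> nat) \<Rightarrow>\<^sub>0 'k) \<subseteq> S"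
  using zero_in by simp

lemmas keys_times_in = keys_times_subset[of _ S, OF _ _ add_in]
lemmas keys_power_in = keys_power_subset[of _ S, OF _ zero_in add_in]

sublocale domain R
proof -
  have "cring R"
  proof (intro cringI abelian_groupI comm_monoidI)
    fix x assume "x \<in> carrier R"
    then show "\<exists>y\<in>carrier R. y \<oplus> x = \<zero>"
      by (intro bexI[of _ "0 - x"]) (simp_all add: keys_minus_subset del: diff_0)
  qed (simp_all add: keys_plus_subset keys_times_in keys_one_in algebra_simps del: keys_one)
  then show "domain R"
    by (rule domain.intro) (unfold_locales, simp_all)
qed

lemma nat_pow_eq [simp]: "a [^] n = a ^ n" for n :: nat
  by (induction n) (simp_all add: mult.commute)

lemma minus_eq:
  assumes "a \<in> carrier R" "a' \<in> carrier R" shows "a \<ominus> a' = a - a'"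
proof -
  have "(a \<ominus> a') + a' = a"
    using assms r_neg[of a'] a_minus_def[of R a a'] by (metis R_simps(3) a_assoc add.inv_closed add.r_inv_ex add.l_inv add.r_one)
  then show ?thesis by (simp add: eq_diff_eq)
qed

lemma ideal_diff:
  assumes "ideal I R" "a \<in> I" "a' \<in> I" shows "a - a' \<in> I"
proof -
  interpret I: ideal I R by fact
  have "a \<ominus> a' \<in> I"
    unfolding a_minus_def using assms by (intro I.a_closed I.a_inv_closed)
  then show ?thesis using minus_eq[OF I.Icarr I.Icarr] assms by simp
qed

text \<open>
  Modulo \<open>P\<close> the power \<open>x\<^sup>i\<^sup>0\<close> can be cancelled from the sum, since \<open>x \<notin> P\<close>. What remains is the lowest
  coefficient plus a multiple of \<open>x\<close>, and \<open>x \<in> P'\<close>.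
\<close>
lemma prime_coefficient_step:
  assumes P: "primeideal P R" and P': "ideal P' R" and "P \<subseteq> P'"
    and x: "x \<in> P'" "x \<notin> P"
    and q: "\<And>i. keys (q i) \<subseteq> S"
    and sum: "(\<Sum>i<N. q i * x ^ i) \<in> P"
    and i0: "i0 < N" "\<And>i. i < i0 \<Longrightarrow> q i = 0"
  shows "q i0 \<in> P'"
proof -
  interpret P: primeideal P R by fact
  interpret P': ideal P' R by fact
  have xS: "keys x \<subseteq> S" using P'.Icarr[OF x(1)] by simp
  \<comment> \<open>The terms above \<open>i0\<close>, divided by \<open>x\<^sup>i\<^sup>0\<^sup>+\<^sup>1\<close>.\<close>
  define t where "t = (\<Sum>i<N - Suc i0. q (Suc i0 + i) * x ^ i)"
  have tS: "keys t \<subseteq> S"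
    unfolding t_def by (intro keys_sum_subset keys_times_in q keys_power_in xS)
  have "(\<Sum>i<N. q i * x ^ i) = (\<Sum>i\<in>{i0..<N}. q i * x ^ i)"
    by (rule sum.mono_neutral_right) (use i0 in auto)
  also have "\<dots> = q i0 * x ^ i0 + (\<Sum>i\<in>{Suc i0..<N}. q i * x ^ i)"
    using i0(1) by (rule sum.atLeast_Suc_lessThan)
  also have "(\<Sum>i\<in>{Suc i0..<N}. q i * x ^ i) = (\<Sum>i<N - Suc i0. q (Suc i0 + i) * x ^ (Suc i0 + i))"
    using sum.shift_bounds_nat_ivl[of "\<lambda>i. q i * x ^ i" 0 "Suc i0" "N - Suc i0"] i0(1)
    by (simp add: add.commute lessThan_atLeast0)
  also have "q i0 * x ^ i0 + \<dots> = x ^ i0 * (q i0 + x * t)"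
    by (simp add: t_def sum_distrib_left algebra_simps power_add)
  finally have "x ^ i0 * (q i0 + x * t) \<in> P" using sum by simp
  moreover have qx: "keys (q i0 + x * t) \<subseteq> S"
    by (intro keys_plus_subset keys_times_in q xS tS)
  moreover have "x ^ n \<notin> P" for n
  proof (induction n)
    case 0
    then show ?case using P.I_notcarr P.one_imp_carrier by auto
  next
    case (Suc n)
    then show ?case using P.I_prime[of x "x ^ n"] x(2) xS keys_power_in[OF xS] by auto
  qed
  ultimately have "q i0 + x * t \<in> P'"
    using P.I_prime[of "x ^ i0" "q i0 + x * t"] keys_power_in[OF xS] \<open>P \<subseteq> P'\<close> by auto
  moreover have "x * t \<in> P'" using P'.I_r_closed[OF x(1), of t] tS by simp
  ultimately have "(q i0 + x * t) - x * t \<in> P'" by (rule ideal_diff[OF P'])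
  then show ?thesis by simp
qed

text \<open>
  Choose \<open>x \<in> P1 - P0\<close> and \<open>y \<in> P2 - P1\<close>. In an algebraic relation between \<open>x, y, z\<close>, the
  lowest coefficient with respect to \<open>x\<close> lies in \<open>P1\<close>, and its lowest coefficient with respect to \<open>y\<close>
  lies in \<open>P2\<close>; the latter is a nonzero polynomial in \<open>z\<close> alone.
\<close>
lemma relation_in_third_prime:
  fixes z :: "(nat \<times> nat) \<Rightarrow>\<^sub>0 'k"
  assumes P: "primeideal P0 R" "primeideal P1 R" "primeideal P2 R"
    and chain: "P0 \<subset> P1" "P1 \<subset> P2" and z: "keys z \<subseteq> S"
  obtains N c where "\<exists>l<N. c l \<noteq> 0" "(\<Sum>l<N. mon 0 (c l) * z ^ l) \<in> P2"
proof -
  interpret P0: primeideal P0 R by fact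
  interpret P1: primeideal P1 R by fact
  interpret P2: primeideal P2 R by fact
  obtain x y where x: "x \<in> P1" "x \<notin> P0" and y: "y \<in> P2" "y \<notin> P1" using chain by blast
  have xyS: "keys x \<subseteq> S" "keys y \<subseteq> S" using P1.Icarr[OF x(1)] P2.Icarr[OF y(1)] by auto
  obtain N c where c: "\<exists>i<N. \<exists>j<N. \<exists>l<N. c i j l \<noteq> (0::'k)"
    and sum: "(\<Sum>i<N. (\<Sum>j<N. (\<Sum>l<N. mon 0 (c i j l) * z ^ l) * y ^ j) * x ^ i) = 0"
    by (rule three_algebraically_dependent[where x = x and y = y and z = z])
  define i0 where "i0 = (LEAST i. \<exists>j<N. \<exists>l<N. c i j l \<noteq> 0)"
  define j0 where "j0 = (LEAST j. \<exists>l<N. c i0 j l \<noteq> 0)"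
  have i0: "\<exists>j<N. \<exists>l<N. c i0 j l \<noteq> 0"
    unfolding i0_def by (rule LeastI_ex) (use c in blast)
  have i0_less: "c i j l = 0" if "i < i0" "j < N" "l < N" for i j l
    using not_less_Least[of i "\<lambda>i. \<exists>j<N. \<exists>l<N. c i j l \<noteq> 0"] that unfolding i0_def by blast
  have j0: "\<exists>l<N. c i0 j0 l \<noteq> 0"
    unfolding j0_def by (rule LeastI_ex) (use i0 in blast)
  have j0_less: "c i0 j l = 0" if "j < j0" "l < N" for j l
    using not_less_Least[of j "\<lambda>j. \<exists>l<N. c i0 j l \<noteq> 0"] that unfolding j0_def by blast
  have "i0 < N" "j0 < N"
  proof -
    from c obtain i where i: "i < N" "\<exists>j<N. \<exists>l<N. c i j l \<noteq> 0" by blast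
    show "i0 < N"
      unfolding i0_def by (rule le_less_trans[OF Least_le[of _ i] i(1)]) (rule i(2))
    from i0 obtain j where j: "j < N" "\<exists>l<N. c i0 j l \<noteq> 0" by blast
    show "j0 < N"
      unfolding j0_def by (rule le_less_trans[OF Least_le[of _ j] j(1)]) (rule j(2))
  qed
  have cS: "keys (\<Sum>l<N. mon 0 (c i j l) * z ^ l) \<subseteq> S" for i j
    by (intro keys_sum_subset keys_times_in keys_power_in z keys_mon_subset zero_in)
  have qS: "keys (\<Sum>j<N. (\<Sum>l<N. mon 0 (c i j l) * z ^ l) * y ^ j) \<subseteq> S" for i
    by (intro keys_sum_subset keys_times_in cS keys_power_in xyS)
  have "(\<Sum>j<N. (\<Sum>l<N. mon 0 (c i0 j l) * z ^ l) * y ^ j) \<in> P1"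
  proof (rule prime_coefficient_step[where N = N and ?i0.0 = i0
        and q = "\<lambda>i. \<Sum>j<N. (\<Sum>l<N. mon 0 (c i j l) * z ^ l) * y ^ j", OF P(1) P1.is_ideal _ x])
    show "(\<Sum>i<N. (\<Sum>j<N. (\<Sum>l<N. mon 0 (c i j l) * z ^ l) * y ^ j) * x ^ i) \<in> P0"
      using sum additive_subgroup.zero_closed[OF P0.is_additive_subgroup] by simp
  qed (use chain \<open>i0 < N\<close> qS in \<open>simp_all add: i0_less psubset_eq\<close>)
  then have "(\<Sum>l<N. mon 0 (c i0 j0 l) * z ^ l) \<in> P2"
    by (intro prime_coefficient_step[where N = N and ?i0.0 = j0
          and q = "\<lambda>j. \<Sum>l<N. mon 0 (c i0 j l) * z ^ l", OF P(2) P2.is_ideal _ y])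
       (use chain \<open>j0 < N\<close> cS in \<open>simp_all add: j0_less psubset_eq\<close>)
  with j0 show thesis by (rule that)
qed

text \<open>
  For \<open>z \<in> P3 - P2\<close>, the lowest coefficient of the polynomial in \<open>z\<close> that lies in \<open>P2\<close> would be a
  nonzero constant, hence a unit, in \<open>P3\<close>.
\<close>
lemma no_chain_of_four_primes:
  assumes P: "primeideal P0 R" "primeideal P1 R" "primeideal P2 R" "primeideal P3 R"
  shows "\<not> (P0 \<subset> P1 \<and> P1 \<subset> P2 \<and> P2 \<subset> P3)"
proof (rule notI, elim conjE)
  assume chain: "P0 \<subset> P1" "P1 \<subset> P2" "P2 \<subset> P3"
  interpret P3: primeideal P3 R by fact
  obtain z where z: "z \<in> P3" "z \<notin> P2" using chain by blast
  then have "keys z \<subseteq> S" using P3.Icarr by auto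
  then obtain N c where c: "\<exists>l<N. c l \<noteq> (0::'k)" "(\<Sum>l<N. mon 0 (c l) * z ^ l) \<in> P2"
    using relation_in_third_prime[OF P(1-3) chain(1,2)] by blast
  define l0 where "l0 = (LEAST l. c l \<noteq> 0)"
  have l0: "c l0 \<noteq> 0" unfolding l0_def by (rule LeastI_ex) (use c in blast)
  have less: "c l = 0" if "l < l0" for l using not_less_Least that unfolding l0_def by blast
  have "l0 < N" using c(1) unfolding l0_def by (meson Least_le le_less_trans)
  have "mon 0 (c l0) \<in> P3"
    by (rule prime_coefficient_step[where q = "\<lambda>l. mon 0 (c l)", OF P(3) P3.is_ideal _ z _ c(2)])
       (use chain \<open>l0 < N\<close> zero_in in \<open>auto simp: less\<close>)
  then have "mon 0 (inverse (c l0)) \<otimes> mon 0 (c l0) \<in> P3"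
    by (rule P3.I_l_closed) (simp add: zero_in)
  then have "\<one> \<in> P3" using l0 by (simp add: mult_single)
  then show False using P3.I_notcarr P3.one_imp_carrier by blast
qed

text \<open>
  A monomial of \<open>a\<close> can be reduced by \<open>p\<close> only if subtracting the leading exponent of \<open>p\<close> stays within
  \<open>S\<close>, hence the condition on the remainder.
\<close>
lemma division_by_leading_exponent:
  fixes p a :: "(nat \<times> nat) \<Rightarrow>\<^sub>0 'k"
  assumes p: "p \<noteq> 0" "keys p \<subseteq> S" and "keys a \<subseteq> S"
  shows "\<exists>q r. keys q \<subseteq> S \<and> keys r \<subseteq> {v \<in> S. \<forall>w\<in>S. v \<noteq> w + lead_exp p} \<and> a = p * q + r"
  using \<open>keys a \<subseteq> S\<close>
proof (induction a rule: lead_exp_induct)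
  case (1 a)
  note IH = 1(1) and aS = 1(2)
  show ?case
  proof (cases "a = 0")
    case True
    then show ?thesis by (intro exI[of _ 0]) simp
  next
    case False
    then have lead_in: "lead_exp a \<in> S" using lead_exp_in_keys aS by blast
    show ?thesis
    proof (cases "\<exists>w\<in>S. lead_exp a = w + lead_exp p")
      case True
      then obtain w where w: "w \<in> S" "lead_exp a = w + lead_exp p" by blast
      let ?m = "mon w (lead_coeff_of a / lead_coeff_of p)"
      have mS: "keys ?m \<subseteq> S" using w by simp
      have "keys (a - ?m * p) \<subseteq> S"
        by (intro keys_minus_subset keys_times_in aS mS p)
      then obtain q r where qr: "keys q \<subseteq> S" "keys r \<subseteq> {v \<in> S. \<forall>w\<in>S. v \<noteq> w + lead_exp p}"
        "a - ?m * p = p * q + r"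
        using IH[OF False keys_reduce_lead[OF p(1) w(2)]] by blast
      then show ?thesis
        by (intro exI[of _ "q + ?m"] exI[of _ r] conjI keys_plus_subset mS) (auto simp: algebra_simps)
    next
      case irreducible: False
      let ?m = "mon (lead_exp a) (lead_coeff_of a)"
      have mS: "keys ?m \<subseteq> {v \<in> S. \<forall>w\<in>S. v \<noteq> w + lead_exp p}"
        using lead_in irreducible by (intro keys_mon_subset) blast
      have less: "\<forall>u\<in>keys (a - ?m). u < lead_exp a"
      proof
        fix u assume "u \<in> keys (a - ?m)"
        then have u: "lookup (a - ?m) u \<noteq> 0" by (simp only: in_keys_iff not_False_eq_True)
        have neq: "lead_exp a \<noteq> u"
        proof
          assume "lead_exp a = u"
          then have "lookup (a - ?m) u = 0" by (simp add: lookup_minus)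
          with u show False by contradiction
        qed
        then have "u \<in> keys a"
          using u by (simp add: lookup_minus lookup_single_not_eq in_keys_iff)
        with neq show "u < lead_exp a" using keys_le_lead_exp[of u a] by simp
      qed
      have "keys (a - ?m) \<subseteq> S"
        using aS mS by (intro keys_minus_subset) auto
      then obtain q r where qr: "keys q \<subseteq> S" "keys r \<subseteq> {v \<in> S. \<forall>w\<in>S. v \<noteq> w + lead_exp p}"
        "a - ?m = p * q + r"
        using IH[OF False less] by blast
      then show ?thesis
        by (intro exI[of _ q] exI[of _ "r + ?m"] conjI keys_plus_subset mS) (auto simp: algebra_simps)
    qed
  qed
qed

end

section \<open>Monoids separated by two rays\<close>

text \<open>
  Dickson's lemma in dimension two: besides one element \<open>(a0, b0)\<close>, the lowest element of each column
  left of \<open>a0\<close> and of each row below \<open>b0\<close> suffice.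
\<close>
lemma dickson_nat_pairs:
  fixes T :: "(nat \<times> nat) set"
  shows "\<exists>F\<subseteq>T. finite F \<and> (\<forall>(i, j)\<in>T. \<exists>(i', j')\<in>F. i' \<le> i \<and> j' \<le> j)"
proof (cases "T = {}")
  case False
  then obtain a0 b0 where ab: "(a0, b0) \<in> T" by auto
  define row where "row = (\<lambda>j. (LEAST i. (i, j) \<in> T, j))"
  define col where "col = (\<lambda>i. (i, LEAST j. (i, j) \<in> T))"
  define F where "F = insert (a0, b0) (row ` {j. j < b0 \<and> (\<exists>i. (i, j) \<in> T)} \<union> col ` {i. i < a0 \<and> (\<exists>j. (i, j) \<in> T)})"
  have "F \<subseteq> T"
    using ab by (auto simp: F_def row_def col_def intro: LeastI)
  moreover have "finite F" by (simp add: F_def)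
  moreover have "\<exists>(i', j')\<in>F. i' \<le> i \<and> j' \<le> j" if "(i, j) \<in> T" for i j
  proof -
    consider "a0 \<le> i" "b0 \<le> j" | "j < b0" | "i < a0" by linarith
    then show ?thesis
    proof cases
      case 1
      then show ?thesis by (auto simp: F_def)
    next
      case 2
      then have "row j \<in> F" using that by (auto simp: F_def)
      then show ?thesis using that by (intro bexI[of _ "row j"]) (auto simp: row_def intro: Least_le)
    next
      case 3
      then have "col i \<in> F" using that by (auto simp: F_def)
      then show ?thesis using that by (intro bexI[of _ "col i"]) (auto simp: col_def intro: Least_le)
    qed
  qed
  ultimately show ?thesis by blast
qed auto

definition multiple :: "nat \<Rightarrow> nat \<times> nat \<Rightarrow> nat \<times> nat" where
  "multiple n v = (n * fst v, n * snd v)"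

abbreviation ray :: "nat \<times> nat \<Rightarrow> (nat \<times> nat) set" where
  "ray v \<equiv> range (\<lambda>n. multiple n v)"

lemma multiple_add: "multiple (m + n) v = multiple m v + multiple n v"
  by (simp add: multiple_def algebra_simps)

lemma zero_in_ray: "0 \<in> ray v"
  by (rule range_eqI[of _ _ 0]) (simp add: multiple_def zero_prod_def)

lemma ray_add: "u \<in> ray v \<Longrightarrow> w \<in> ray v \<Longrightarrow> u + w \<in> ray v"
  by (auto simp: multiple_add[symmetric])

text \<open>
  The separation axiom says that an element \<open>t\<close> of the group generated by \<open>S\<close> belongs to \<open>S\<close> as soon as
  \<open>t + a\<close> and \<open>t + c\<close> do, for some \<open>a\<close> and \<open>c\<close> on the two rays; it is phrased with \<open>u = t + a\<close> and
  \<open>w = t + c\<close> to avoid subtraction in \<open>\<nat>\<^sup>2\<close>. For affine monoids of rank two this is the usual criterion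
  for \<open>\<k>[S]\<close> to be Cohen-Macaulay. The representatives in \<open>finite_over_rays\<close> may lie outside \<open>S\<close>.
\<close>
locale cm_plane_monoid = plane_monoid S R
  for S :: "(nat \<times> nat) set" and R :: "((nat \<times> nat) \<Rightarrow>\<^sub>0 'k::field) ring" (structure) +
  fixes e1 e2 :: "nat \<times> nat"
  assumes e1_in: "e1 \<in> S" and e2_in: "e2 \<in> S"
    and e1_nonzero: "e1 \<noteq> 0" and e2_nonzero: "e2 \<noteq> 0"
    and separation: "u \<in> S \<Longrightarrow> w \<in> S \<Longrightarrow> a \<in> ray e1 \<Longrightarrow> c \<in> ray e2 \<Longrightarrow> u + c = w + a \<Longrightarrow>
      \<exists>t\<in>S. u = t + a"
    and finite_over_rays: "\<exists>F. finite F \<and> (\<forall>v\<in>S. \<exists>r\<in>F. \<exists>i j. v = r + multiple i e1 + multiple j e2)"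
begin

lemma ray_subset: "e \<in> S \<Longrightarrow> ray e \<subseteq> S"
proof (rule image_subsetI)
  fix n assume "e \<in> S"
  then show "multiple n e \<in> S"
  proof (induction n)
    case (Suc n)
    then show ?case using add_in[of e "multiple n e"] multiple_add[of 1 n e] by (simp add: multiple_def)
  qed (use zero_in in \<open>simp add: multiple_def zero_prod_def\<close>)
qed

text \<open>
  Divide \<open>a\<close> by \<open>p\<close>, with remainder \<open>r\<close>; then \<open>q r\<close> is a multiple \<open>p c'\<close>. If \<open>c'\<close> were nonzero, its
  leading exponent plus that of \<open>p\<close> would be an exponent \<open>v\<close> of \<open>r\<close> plus a vector of the second ray. By
  separation, \<open>v\<close> minus the leading exponent of \<open>p\<close> would lie in \<open>S\<close>, so \<open>v\<close> would have been reduced.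
\<close>
lemma axis_polynomials_regular:
  fixes p q a c :: "(nat \<times> nat) \<Rightarrow>\<^sub>0 'k"
  assumes p: "keys p \<subseteq> ray e1" "p \<noteq> 0" and q: "keys q \<subseteq> ray e2" "q \<noteq> 0"
    and a: "keys a \<subseteq> S" and c: "keys c \<subseteq> S" and eq: "q * a = p * c"
  shows "\<exists>a'. keys a' \<subseteq> S \<and> a = p * a'"
proof -
  have pS: "keys p \<subseteq> S" and qS: "keys q \<subseteq> S" using p q ray_subset e1_in e2_in by blast+
  obtain a' r where ar: "keys a' \<subseteq> S" "keys r \<subseteq> {v \<in> S. \<forall>w\<in>S. v \<noteq> w + lead_exp p}" "a = p * a' + r"
    using division_by_leading_exponent[OF p(2) pS a] by blast
  define c' where "c' = c - q * a'"
  have qr: "q * r = p * c'" using eq ar(3) by (simp add: c'_def algebra_simps)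
  have c'S: "keys c' \<subseteq> S"
    unfolding c'_def by (intro keys_minus_subset keys_times_in c qS ar)
  have "c' = 0"
  proof (rule ccontr)
    assume c': "c' \<noteq> 0"
    then have "lead_exp p + lead_exp c' \<in> keys (q * r)"
      using lead_exp_add_in_keys_mult[OF p(2) c'] by (simp add: qr)
    then obtain u v where uv: "u \<in> keys q" "v \<in> keys r" "lead_exp p + lead_exp c' = u + v"
      using keys_mult[of q r] by blast
    have "v + u = lead_exp c' + lead_exp p" using uv(3) by (simp add: add.commute)
    moreover have "v \<in> S" "lead_exp c' \<in> S" "lead_exp p \<in> ray e1" "u \<in> ray e2"
      using uv ar(2) lead_exp_in_keys[OF c'] lead_exp_in_keys[OF p(2)] c'S p(1) q(1) by blast+
    ultimately obtain t where "t \<in> S" "v = t + lead_exp p" using separation by blast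
    then show False using uv(2) ar(2) by blast
  qed
  then have "r = 0" using qr q(2) by simp
  then show ?thesis using ar by auto
qed

text \<open>
  Elements of \<open>L\<close> with the same representative modulo the rays are compared by their two multiplicities, to which
  Dickson's lemma applies.
\<close>
lemma finitely_many_exponents_generate:
  assumes "L \<subseteq> S"
  shows "\<exists>F\<subseteq>L. finite F \<and> (\<forall>v\<in>L. \<exists>u\<in>F. \<exists>s\<in>S. v = s + u)"
proof -
  obtain F where F: "finite F" "\<forall>v\<in>S. \<exists>r\<in>F. \<exists>i j. v = r + multiple i e1 + multiple j e2"
    using finite_over_rays by blast
  define pt where "pt = (\<lambda>r (i, j). r + multiple i e1 + multiple j e2)"
  have "\<forall>r. \<exists>G. G \<subseteq> {x. pt r x \<in> L} \<and> finite G \<and>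
      (\<forall>(i, j)\<in>{x. pt r x \<in> L}. \<exists>(i', j')\<in>G. i' \<le> i \<and> j' \<le> j)"
    by (intro allI dickson_nat_pairs)
  from choice[OF this] obtain G where "\<forall>r. G r \<subseteq> {x. pt r x \<in> L} \<and> finite (G r) \<and>
      (\<forall>(i, j)\<in>{x. pt r x \<in> L}. \<exists>(i', j')\<in>G r. i' \<le> i \<and> j' \<le> j)"
    by (rule exE)
  note this[rule_format]
  then have G: "G r \<subseteq> {x. pt r x \<in> L}" "finite (G r)"
    and G_below: "(i, j) \<in> {x. pt r x \<in> L} \<Longrightarrow> \<exists>(i', j')\<in>G r. i' \<le> i \<and> j' \<le> j" for r i j
    by fastforce+
  define H where "H = (\<Union>r\<in>F. pt r ` G r)"
  have "\<exists>u\<in>H. \<exists>s\<in>S. v = s + u" if v: "v \<in> L" for v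
  proof -
    have "v \<in> S" using v assms by blast
    then obtain r i j where "r \<in> F" "v = r + multiple i e1 + multiple j e2" using F(2) by blast
    then have r: "r \<in> F" "v = pt r (i, j)" by (simp_all add: pt_def)
    then obtain i' j' where ij: "(i', j') \<in> G r" "i' \<le> i" "j' \<le> j" using G_below[of i j r] v by auto
    then have "v = (multiple (i - i') e1 + multiple (j - j') e2) + pt r (i', j')"
      using multiple_add[of "i - i'" i' e1] multiple_add[of "j - j'" j' e2] r(2)
      by (simp add: pt_def ac_simps)
    moreover have "multiple (i - i') e1 + multiple (j - j') e2 \<in> S"
      using ray_subset e1_in e2_in by (intro add_in) blast+
    moreover have "pt r (i', j') \<in> H" using r ij by (auto simp: H_def)
    ultimately show ?thesis by blast
  qed
  moreover have "H \<subseteq> L" unfolding H_def using G(1) by blast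
  moreover have "finite H" unfolding H_def using G(2) F(1) by blast
  ultimately show ?thesis by blast
qed

text \<open>
  As in the theory of Groebner bases: elements of \<open>I\<close> whose leading exponents generate all leading
  exponents of \<open>I\<close> generate \<open>I\<close>.
\<close>
lemma R_noetherian: "noetherian_ring R"
proof (rule noetherian_ringI)
  fix I assume I: "ideal I R"
  interpret I: ideal I R by fact
  define L where "L = lead_exp ` (I - {0})"
  have "lead_exp a \<in> S" if "a \<in> I" "a \<noteq> 0" for a
    using I.Icarr[OF that(1)] lead_exp_in_keys[OF that(2)] by auto
  then have "L \<subseteq> S" unfolding L_def by blast
  from finitely_many_exponents_generate[OF this] obtain F
    where F: "F \<subseteq> L" "finite F" "\<forall>v\<in>L. \<exists>u\<in>F. \<exists>s\<in>S. v = s + u"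
    by blast
  have "\<forall>u\<in>F. \<exists>p. p \<in> I \<and> p \<noteq> 0 \<and> lead_exp p = u" using F(1) unfolding L_def by blast
  from bchoice[OF this] obtain p where p: "\<And>u. u \<in> F \<Longrightarrow> p u \<in> I \<and> p u \<noteq> 0 \<and> lead_exp (p u) = u"
    by blast
  have pc: "p ` F \<subseteq> carrier R" using p I.Icarr by blast
  interpret J: ideal "Idl (p ` F)" R by (rule genideal_ideal[OF pc])
  have "Idl (p ` F) \<subseteq> I" using p by (intro genideal_minimal I) auto
  moreover have "a \<in> Idl (p ` F)" if "a \<in> I" for a
    using that
  proof (induction a rule: lead_exp_induct)
    case (1 a)
    show ?case
    proof (cases "a = 0")
      case True
      then show ?thesis using additive_subgroup.zero_closed[OF J.is_additive_subgroup] by simp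
    next
      case False
      then have "lead_exp a \<in> L" using 1(2) by (auto simp: L_def)
      then obtain u s where u: "u \<in> F" "s \<in> S" "lead_exp a = s + u" using F(3) by blast
      let ?m = "mon s (lead_coeff_of a / lead_coeff_of (p u))"
      have m: "?m \<in> carrier R" using u by simp
      have mpI: "?m * p u \<in> I" using I.I_l_closed[of "p u" ?m] p[OF u(1)] m by simp
      have mpJ: "?m * p u \<in> Idl (p ` F)"
        using J.I_l_closed[of "p u" ?m] genideal_self[OF pc] u m by auto
      have "a - ?m * p u \<in> I" by (rule ideal_diff[OF I 1(2) mpI])
      moreover have "\<forall>v\<in>keys (a - ?m * p u). v < lead_exp a"
        using keys_reduce_lead[of "p u" a s] p[OF u(1)] u by simp
      ultimately have "a - ?m * p u \<in> Idl (p ` F)" using 1(1)[OF False] by blast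
      then have "(a - ?m * p u) \<oplus> ?m * p u \<in> Idl (p ` F)" using mpJ by (rule J.a_closed)
      then show ?thesis by simp
    qed
  qed
  ultimately show "\<exists>A\<subseteq>carrier R. finite A \<and> I = Idl A"
    using pc F(2) by (intro exI[of _ "p ` F"]) auto
qed

end

section \<open>Localization of a domain at a prime\<close>

lemma (in cring) idealI_commutative:
  assumes "I \<subseteq> carrier R" "I \<noteq> {}"
    and add: "\<And>a b. a \<in> I \<Longrightarrow> b \<in> I \<Longrightarrow> a \<oplus> b \<in> I"
    and mult: "\<And>a x. a \<in> I \<Longrightarrow> x \<in> carrier R \<Longrightarrow> x \<otimes> a \<in> I"
  shows "ideal I R"
proof (rule idealI[OF ring_axioms add.subgroupI])
  fix a assume "a \<in> I"
  then have "\<ominus> a = (\<ominus> \<one>) \<otimes> a" using assms(1) by (auto simp: l_minus)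
  then show "\<ominus> a \<in> I" using mult[OF \<open>a \<in> I\<close>, of "\<ominus> \<one>"] by simp
next
  fix a x assume "a \<in> I" "x \<in> carrier R"
  then show "a \<otimes> x \<in> I" using mult[of a x] assms(1) by (simp add: m_comm subset_iff)
qed (use assms in auto)

text \<open>
  In a domain the factor \<open>u\<close> in the definition of equality of fractions can be cancelled, and fractions
  are compared by cross multiplication.
\<close>
locale domain_at_prime = domain R + primeideal P R for R (structure) and P
begin

abbreviation valid :: "'a \<Rightarrow> 'a \<Rightarrow> bool" where
  "valid a s \<equiv> a \<in> carrier R \<and> s \<in> carrier R - P"

abbreviation frac :: "'a \<Rightarrow> 'a \<Rightarrow> ('a \<times> 'a) set" where
  "frac \<equiv> loc_frac R P"

abbreviation L :: "('a \<times> 'a) set ring" where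
  "L \<equiv> localization R P"

abbreviation embed :: "'a \<Rightarrow> ('a \<times> 'a) set" where
  "embed a \<equiv> frac a \<one>"

lemma not_in_P_nonzero: "s \<in> carrier R - P \<Longrightarrow> s \<noteq> \<zero>"
  using additive_subgroup.zero_closed[OF is_additive_subgroup] by auto

lemma one_valid: "\<one> \<in> carrier R - P"
  using I_notcarr one_imp_carrier by auto

lemma mult_valid: "s \<in> carrier R - P \<Longrightarrow> t \<in> carrier R - P \<Longrightarrow> s \<otimes> t \<in> carrier R - P"
  using I_prime by auto

lemma loc_rel_iff:
  "((a, s), (b, t)) \<in> loc_rel R P \<longleftrightarrow> valid a s \<and> valid b t \<and> a \<otimes> t = b \<otimes> s"
proof (cases "valid a s \<and> valid b t")
  case True
  then have "(\<exists>u\<in>carrier R - P. u \<otimes> (a \<otimes> t \<ominus> b \<otimes> s) = \<zero>) \<longleftrightarrow> a \<otimes> t \<ominus> b \<otimes> s = \<zero>"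
    using integral_iff not_in_P_nonzero one_valid by (metis DiffD1 m_closed minus_closed r_null)
  also have "\<dots> \<longleftrightarrow> a \<otimes> t = b \<otimes> s"
    using True by (intro r_right_minus_eq) auto
  finally show ?thesis using True by (simp add: loc_rel_def)
qed (auto simp: loc_rel_def)

lemma loc_rel_equiv: "equiv (carrier R \<times> (carrier R - P)) (loc_rel R P)"
proof (rule equivI)
  show "refl_on (carrier R \<times> (carrier R - P)) (loc_rel R P)"
    by (auto simp: refl_on_def loc_rel_iff)
  show "sym (loc_rel R P)" by (auto simp: sym_def loc_rel_iff)
  show "trans (loc_rel R P)"
  proof (rule transI, clarify)
    fix a s b t c u
    assume "((a, s), (b, t)) \<in> loc_rel R P" "((b, t), (c, u)) \<in> loc_rel R P"
    then have v: "valid a s" "valid b t" "valid c u" and eq: "a \<otimes> t = b \<otimes> s" "b \<otimes> u = c \<otimes> t"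
      by (auto simp: loc_rel_iff)
    have "t \<otimes> (a \<otimes> u) = (a \<otimes> t) \<otimes> u" using v by (simp add: m_ac)
    also have "\<dots> = s \<otimes> (b \<otimes> u)" unfolding eq(1) using v by (simp add: m_ac)
    also have "\<dots> = t \<otimes> (c \<otimes> s)" unfolding eq(2) using v by (simp add: m_ac)
    finally have "a \<otimes> u = c \<otimes> s"
      using v not_in_P_nonzero m_lcancel[of t "a \<otimes> u" "c \<otimes> s"] by auto
    then show "((a, s), (c, u)) \<in> loc_rel R P" using v by (simp add: loc_rel_iff)
  qed
  show "loc_rel R P \<subseteq> (carrier R \<times> (carrier R - P)) \<times> (carrier R \<times> (carrier R - P))"
    by (auto simp: loc_rel_iff)
qed

lemma frac_eq_iff:
  assumes "valid a s" "valid b t"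
  shows "frac a s = frac b t \<longleftrightarrow> a \<otimes> t = b \<otimes> s"
  using eq_equiv_class_iff[OF loc_rel_equiv, of "(a, s)" "(b, t)"] assms
  by (auto simp: loc_frac_def loc_rel_iff)

lemma mem_frac_iff: "valid a s \<Longrightarrow> (b, t) \<in> frac a s \<longleftrightarrow> valid b t \<and> a \<otimes> t = b \<otimes> s"
  by (auto simp: loc_frac_def loc_rel_iff)

lemma self_in_frac: "valid a s \<Longrightarrow> (a, s) \<in> frac a s"
  by (simp add: mem_frac_iff)

lemma frac_mult:
  assumes "valid a s" "valid b t"
  shows "frac a s \<otimes>\<^bsub>L\<^esub> frac b t = frac (a \<otimes> b) (s \<otimes> t)"
proof -
  have eq: "frac (a' \<otimes> b') (s' \<otimes> t') = frac (a \<otimes> b) (s \<otimes> t)"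
    if "(a', s') \<in> frac a s" "(b', t') \<in> frac b t" for a' s' b' t'
  proof -
    have v: "valid a' s'" "valid b' t'" and e: "a \<otimes> s' = a' \<otimes> s" "b \<otimes> t' = b' \<otimes> t"
      using that assms by (auto simp: mem_frac_iff)
    have "(a' \<otimes> b') \<otimes> (s \<otimes> t) = (a' \<otimes> s) \<otimes> (b' \<otimes> t)" using v assms by (simp add: m_ac)
    also have "\<dots> = (a \<otimes> b) \<otimes> (s' \<otimes> t')" unfolding e[symmetric] using v assms by (simp add: m_ac)
    finally show ?thesis
      using v assms mult_valid by (subst frac_eq_iff) auto
  qed
  have "(\<Union>(a', s')\<in>frac a s. \<Union>(b', t')\<in>frac b t. frac (a' \<otimes> b') (s' \<otimes> t')) = frac (a \<otimes> b) (s \<otimes> t)"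
    using eq self_in_frac[OF assms(1)] self_in_frac[OF assms(2)] by fast
  then show ?thesis by (simp add: localization_def)
qed

lemma frac_add:
  assumes "valid a s" "valid b t"
  shows "frac a s \<oplus>\<^bsub>L\<^esub> frac b t = frac (a \<otimes> t \<oplus> b \<otimes> s) (s \<otimes> t)"
proof -
  have eq: "frac (a' \<otimes> t' \<oplus> b' \<otimes> s') (s' \<otimes> t') = frac (a \<otimes> t \<oplus> b \<otimes> s) (s \<otimes> t)"
    if "(a', s') \<in> frac a s" "(b', t') \<in> frac b t" for a' s' b' t'
  proof -
    have v: "valid a' s'" "valid b' t'" and e: "a \<otimes> s' = a' \<otimes> s" "b \<otimes> t' = b' \<otimes> t"
      using that assms by (auto simp: mem_frac_iff)
    have "(a' \<otimes> t' \<oplus> b' \<otimes> s') \<otimes> (s \<otimes> t) = (a' \<otimes> s) \<otimes> (t \<otimes> t') \<oplus> (b' \<otimes> t) \<otimes> (s \<otimes> s')"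
      using v assms by (simp add: m_ac l_distr r_distr)
    also have "\<dots> = (a \<otimes> t \<oplus> b \<otimes> s) \<otimes> (s' \<otimes> t')"
      unfolding e[symmetric] using v assms by (simp add: m_ac l_distr r_distr)
    finally show ?thesis
      using v assms mult_valid by (subst frac_eq_iff) auto
  qed
  have "(\<Union>(a', s')\<in>frac a s. \<Union>(b', t')\<in>frac b t. frac (a' \<otimes> t' \<oplus> b' \<otimes> s') (s' \<otimes> t')) =
      frac (a \<otimes> t \<oplus> b \<otimes> s) (s \<otimes> t)"
    using eq self_in_frac[OF assms(1)] self_in_frac[OF assms(2)] by fast
  then show ?thesis by (simp add: localization_def)
qed

lemma loc_one: "\<one>\<^bsub>L\<^esub> = embed \<one>" and loc_zero: "\<zero>\<^bsub>L\<^esub> = embed \<zero>"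
  by (simp_all add: localization_def)

lemma loc_carrier: "z \<in> carrier L \<longleftrightarrow> (\<exists>a s. valid a s \<and> z = frac a s)"
  by (auto simp: localization_def quotient_def loc_frac_def)

lemma frac_closed: "valid a s \<Longrightarrow> frac a s \<in> carrier L"
  by (auto simp: loc_carrier)

lemma frac_eq_zero_iff: "valid a s \<Longrightarrow> frac a s = \<zero>\<^bsub>L\<^esub> \<longleftrightarrow> a = \<zero>"
  using one_valid by (simp add: loc_zero frac_eq_iff)

lemma embed_closed: "a \<in> carrier R \<Longrightarrow> embed a \<in> carrier L"
  using one_valid by (intro frac_closed) simp

lemma localization_cring: "cring L"
proof (intro cringI abelian_groupI comm_monoidI)
  note simps = frac_mult frac_add mult_valid one_valid[simplified] loc_one loc_zero frac_eq_iff
    m_ac a_ac l_distr r_distr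
  have closed [simp]: "s \<in> carrier R \<and> s \<notin> P \<Longrightarrow> t \<in> carrier R \<and> t \<notin> P \<Longrightarrow> s \<otimes> t \<notin> P" for s t
    using mult_valid by blast
  show "\<one>\<^bsub>L\<^esub> \<in> carrier L" "\<zero>\<^bsub>L\<^esub> \<in> carrier L" by (simp_all add: loc_one loc_zero embed_closed)
  fix x assume "x \<in> carrier L"
  then obtain a s where x: "x = frac a s" "valid a s" by (auto simp: loc_carrier)
  show "\<zero>\<^bsub>L\<^esub> \<oplus>\<^bsub>L\<^esub> x = x" "\<one>\<^bsub>L\<^esub> \<otimes>\<^bsub>L\<^esub> x = x" using x by (simp_all add: simps)
  show "\<exists>y\<in>carrier L. y \<oplus>\<^bsub>L\<^esub> x = \<zero>\<^bsub>L\<^esub>"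
    using x by (intro bexI[of _ "frac (\<ominus> a) s"]) (simp_all add: simps frac_closed r_minus l_neg r_neg)
  fix y assume "y \<in> carrier L"
  then obtain b t where y: "y = frac b t" "valid b t" by (auto simp: loc_carrier)
  show "x \<oplus>\<^bsub>L\<^esub> y \<in> carrier L" "x \<otimes>\<^bsub>L\<^esub> y \<in> carrier L"
    using x y by (simp_all add: frac_mult frac_add frac_closed)
  show "x \<oplus>\<^bsub>L\<^esub> y = y \<oplus>\<^bsub>L\<^esub> x" "x \<otimes>\<^bsub>L\<^esub> y = y \<otimes>\<^bsub>L\<^esub> x"
    using x y by (simp_all add: simps)
  fix z assume "z \<in> carrier L"
  then obtain c u where z: "z = frac c u" "valid c u" by (auto simp: loc_carrier)
  show "(x \<oplus>\<^bsub>L\<^esub> y) \<oplus>\<^bsub>L\<^esub> z = x \<oplus>\<^bsub>L\<^esub> (y \<oplus>\<^bsub>L\<^esub> z)" "(x \<otimes>\<^bsub>L\<^esub> y) \<otimes>\<^bsub>L\<^esub> z = x \<otimes>\<^bsub>L\<^esub> (y \<otimes>\<^bsub>L\<^esub> z)"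
    "(x \<oplus>\<^bsub>L\<^esub> y) \<otimes>\<^bsub>L\<^esub> z = x \<otimes>\<^bsub>L\<^esub> z \<oplus>\<^bsub>L\<^esub> y \<otimes>\<^bsub>L\<^esub> z"
    using x y z by (simp_all add: simps)
qed

sublocale L: domain L
proof -
  interpret L: cring L by (rule localization_cring)
  show "domain L"
  proof
    show "\<one>\<^bsub>L\<^esub> \<noteq> \<zero>\<^bsub>L\<^esub>" using frac_eq_zero_iff[of \<one> \<one>] one_valid by (simp add: loc_one)
    fix x y assume "x \<otimes>\<^bsub>L\<^esub> y = \<zero>\<^bsub>L\<^esub>" "x \<in> carrier L" "y \<in> carrier L"
    then obtain a s b t where "valid a s" "x = frac a s" "valid b t" "y = frac b t"
      by (auto simp: loc_carrier)
    then show "x = \<zero>\<^bsub>L\<^esub> \<or> y = \<zero>\<^bsub>L\<^esub>"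
      using \<open>x \<otimes>\<^bsub>L\<^esub> y = \<zero>\<^bsub>L\<^esub>\<close> mult_valid integral by (auto simp: frac_mult frac_eq_zero_iff)
  qed
qed

lemma embed_hom: "ring_hom_cring R L embed"
proof (rule ring_hom_cringI[OF is_cring L.is_cring ring_hom_memI])
  show "embed (a \<otimes> b) = embed a \<otimes>\<^bsub>L\<^esub> embed b" "embed (a \<oplus> b) = embed a \<oplus>\<^bsub>L\<^esub> embed b"
    if "a \<in> carrier R" "b \<in> carrier R" for a b
    using that one_valid by (simp_all add: frac_mult frac_add)
qed (simp_all add: embed_closed loc_one)

lemma embed_times_frac:
  assumes "valid a s"
  shows "embed s \<otimes>\<^bsub>L\<^esub> frac a s = embed a"
  using assms one_valid by (simp add: frac_mult frac_eq_iff m_comm)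

lemma frac_eq_embed_times:
  assumes "valid a s"
  shows "frac a s = embed a \<otimes>\<^bsub>L\<^esub> frac \<one> s"
  using assms one_valid by (simp add: frac_mult)

definition max_ideal :: "('a \<times> 'a) set set" where
  "max_ideal = {frac a s | a s. a \<in> P \<and> s \<in> carrier R - P}"

lemma frac_in_max_ideal_iff:
  assumes "valid a s" shows "frac a s \<in> max_ideal \<longleftrightarrow> a \<in> P"
proof
  assume "frac a s \<in> max_ideal"
  then obtain b t where b: "b \<in> P" "t \<in> carrier R - P" "frac a s = frac b t" by (auto simp: max_ideal_def)
  then have "valid b t" using Icarr by simp
  then have "a \<otimes> t = b \<otimes> s" using b assms frac_eq_iff by simp
  then have "a \<otimes> t \<in> P" using I_r_closed[OF b(1), of s] assms by simp
  then show "a \<in> P" using I_prime[of a t] assms b by auto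
qed (use assms in \<open>auto simp: max_ideal_def\<close>)

lemma max_ideal_ideal: "ideal max_ideal L"
proof (rule L.idealI_commutative)
  show "max_ideal \<subseteq> carrier L" using frac_closed Icarr by (auto simp: max_ideal_def)
  show "max_ideal \<noteq> {}"
    using frac_in_max_ideal_iff[of \<zero> \<one>] one_valid additive_subgroup.zero_closed[OF is_additive_subgroup]
    by auto
  fix x y assume "x \<in> max_ideal" "y \<in> max_ideal"
  then obtain a s b t where x: "x = frac a s" "a \<in> P" "s \<in> carrier R - P"
    and y: "y = frac b t" "b \<in> P" "t \<in> carrier R - P" by (auto simp: max_ideal_def)
  then have v: "valid a s" "valid b t" using Icarr by auto
  show "x \<oplus>\<^bsub>L\<^esub> y \<in> max_ideal"
    using x y v mult_valid[of s t] unfolding x(1) y(1)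
    by (subst frac_add) (auto simp: frac_in_max_ideal_iff intro!: a_closed I_r_closed)
next
  fix x y assume "x \<in> max_ideal" "y \<in> carrier L"
  then obtain a s b t where x: "x = frac a s" "a \<in> P" "s \<in> carrier R - P"
    and y: "y = frac b t" "valid b t" by (auto simp: max_ideal_def loc_carrier)
  then have v: "valid a s" using Icarr by auto
  have "frac (b \<otimes> a) (t \<otimes> s) \<in> max_ideal"
    using x y v mult_valid[of t s] I_l_closed by (auto simp: frac_in_max_ideal_iff)
  then show "y \<otimes>\<^bsub>L\<^esub> x \<in> max_ideal" using x y v by (simp add: frac_mult)
qed

lemma max_ideal_complement_unit:
  assumes "z \<in> carrier L - max_ideal"
  shows "\<exists>w\<in>carrier L. z \<otimes>\<^bsub>L\<^esub> w = \<one>\<^bsub>L\<^esub>"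
proof -
  obtain a s where z: "z = frac a s" "valid a s" using assms by (auto simp: loc_carrier)
  then have a: "a \<in> carrier R - P" using assms frac_in_max_ideal_iff by auto
  then have "z \<otimes>\<^bsub>L\<^esub> frac s a = \<one>\<^bsub>L\<^esub>"
    using z one_valid mult_valid[of s a] by (simp add: frac_mult loc_one frac_eq_iff m_comm)
  then show ?thesis using z a frac_closed by blast
qed

lemma max_ideal_proper: "\<one>\<^bsub>L\<^esub> \<notin> max_ideal"
  using frac_in_max_ideal_iff[of \<one> \<one>] one_valid by (simp add: loc_one)

text \<open>Every ideal of the localization is the extension of its contraction.\<close>
lemma localization_noetherian:
  assumes "noetherian_ring R"
  shows "noetherian_ring L"
proof (rule L.noetherian_ringI)
  fix I assume I: "ideal I L"
  interpret I: ideal I L by fact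
  interpret embed: ring_hom_cring R L embed by (rule embed_hom)
  have "ideal {r \<in> carrier R. embed r \<in> I} R" by (rule embed.ring.ideal_vimage[OF I])
  then obtain A where A: "A \<subseteq> carrier R" "finite A" "{r \<in> carrier R. embed r \<in> I} = Idl A"
    using noetherian_ring.finetely_gen[OF assms] by blast
  have eA: "embed ` A \<subseteq> carrier L" using A(1) embed_closed by blast
  interpret J: ideal "Idl\<^bsub>L\<^esub> (embed ` A)" L by (rule L.genideal_ideal[OF eA])
  have "embed ` A \<subseteq> I" using genideal_self[OF A(1)] A(3) by blast
  then have "Idl\<^bsub>L\<^esub> (embed ` A) \<subseteq> I" by (rule L.genideal_minimal[OF I])
  moreover have "z \<in> Idl\<^bsub>L\<^esub> (embed ` A)" if z: "z \<in> I" for z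
  proof -
    obtain a s where as: "z = frac a s" "valid a s" using I.Icarr[OF z] by (auto simp: loc_carrier)
    have "ideal {r \<in> carrier R. embed r \<in> Idl\<^bsub>L\<^esub> (embed ` A)} R"
      by (rule embed.ring.ideal_vimage[OF J.is_ideal])
    moreover have "A \<subseteq> {r \<in> carrier R. embed r \<in> Idl\<^bsub>L\<^esub> (embed ` A)}"
      using A(1) L.genideal_self[OF eA] by blast
    ultimately have "Idl A \<subseteq> {r \<in> carrier R. embed r \<in> Idl\<^bsub>L\<^esub> (embed ` A)}"
      by (rule genideal_minimal)
    moreover have "embed a \<in> I"
      using I.I_l_closed[OF z, of "embed s"] as embed_times_frac[OF as(2)] embed_closed by simp
    ultimately have "embed a \<in> Idl\<^bsub>L\<^esub> (embed ` A)" using A(3) as(2) by blast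
    then show ?thesis
      using J.I_r_closed[of "embed a" "frac \<one> s"] as frac_eq_embed_times[OF as(2)] frac_closed[of \<one> s]
      by simp
  qed
  ultimately show "\<exists>A\<subseteq>carrier L. finite A \<and> I = Idl\<^bsub>L\<^esub> A"
    using eA A(2) by (intro exI[of _ "embed ` A"]) auto
qed

lemma contract_prime:
  assumes "primeideal Q L"
  shows "primeideal {r \<in> carrier R. embed r \<in> Q} R"
proof -
  interpret embed: ring_hom_cring R L embed by (rule embed_hom)
  show ?thesis by (rule embed.ring.primeideal_vimage[OF is_cring assms])
qed

text \<open>Numerators generate the same ideals as fractions, so contraction of primes is injective.\<close>
lemma contract_strict:
  assumes Q: "primeideal Q L" and Q': "primeideal Q' L" and "Q \<subset> Q'"
  shows "{r \<in> carrier R. embed r \<in> Q} \<subset> {r \<in> carrier R. embed r \<in> Q'}"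
proof -
  interpret Q: primeideal Q L by fact
  interpret Q': primeideal Q' L by fact
  obtain z where z: "z \<in> Q'" "z \<notin> Q" using \<open>Q \<subset> Q'\<close> by blast
  obtain a s where as: "z = frac a s" "valid a s" using Q'.Icarr[OF z(1)] by (auto simp: loc_carrier)
  have "embed a \<in> Q'"
    using Q'.I_l_closed[OF z(1), of "embed s"] as embed_times_frac[OF as(2)] embed_closed by simp
  moreover have "embed a \<notin> Q"
  proof
    assume "embed a \<in> Q"
    then show False
      using Q.I_r_closed[of "embed a" "frac \<one> s"] as frac_eq_embed_times[OF as(2)] frac_closed[of \<one> s] z(2)
      by simp
  qed
  ultimately show ?thesis using \<open>Q \<subset> Q'\<close> as(2) by blast
qed

text \<open>Regularity survives localization: clear denominators, divide in \<open>R\<close>, and divide by the denominators again.\<close>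
lemma embed_regular_pair:
  assumes pq: "p \<in> carrier R" "q \<in> carrier R"
    and reg: "\<And>a c. a \<in> carrier R \<Longrightarrow> c \<in> carrier R \<Longrightarrow> q \<otimes> a = p \<otimes> c \<Longrightarrow> \<exists>a'\<in>carrier R. a = p \<otimes> a'"
    and xy: "x \<in> carrier L" "y \<in> carrier L" and eq: "embed q \<otimes>\<^bsub>L\<^esub> x = embed p \<otimes>\<^bsub>L\<^esub> y"
  shows "\<exists>x'\<in>carrier L. x = embed p \<otimes>\<^bsub>L\<^esub> x'"
proof -
  obtain a s b t where x: "x = frac a s" "valid a s" and y: "y = frac b t" "valid b t"
    using xy by (auto simp: loc_carrier)
  have "q \<otimes> a \<otimes> t = p \<otimes> b \<otimes> s"
    using eq x y pq one_valid mult_valid by (simp add: frac_mult frac_eq_iff)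
  then have "q \<otimes> (a \<otimes> t) = p \<otimes> (b \<otimes> s)" using x y pq by (simp add: m_assoc)
  then obtain a' where a': "a' \<in> carrier R" "a \<otimes> t = p \<otimes> a'"
    using reg[of "a \<otimes> t" "b \<otimes> s"] x y by auto
  have st: "s \<otimes> t \<in> carrier R - P" using mult_valid x y by simp
  have "a \<otimes> (s \<otimes> t) = (a \<otimes> t) \<otimes> s" using x y by (simp add: m_ac)
  also have "\<dots> = p \<otimes> a' \<otimes> s" by (simp only: a'(2))
  finally have "x = embed p \<otimes>\<^bsub>L\<^esub> frac a' (s \<otimes> t)"
    using x y pq a' one_valid st by (simp add: frac_mult frac_eq_iff)
  then show ?thesis using a' st frac_closed by blast
qed

end

section \<open>Weak sequences in local domains\<close>

text \<open>
  A finite positive supremum is attained. For the value \<open>0\<close> this would fail, since it is also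
  the supremum of the empty set.
\<close>
lemma chain_length_sup_attained:
  assumes "chain_length_sup F = enat (Suc n)"
  shows "\<exists>C. (\<forall>i\<le>Suc n. C i \<in> F) \<and> (\<forall>i<Suc n. C i \<subset> C (Suc i))"
proof (rule ccontr)
  assume none: "\<not> ?thesis"
  let ?E = "{enat m | m. \<exists>C. (\<forall>i\<le>m. C i \<in> F) \<and> (\<forall>i<m. C i \<subset> C (Suc i))}"
  have "Sup ?E \<le> enat n"
  proof (rule Sup_least)
    fix e assume e: "e \<in> ?E"
    then obtain m where m: "e = enat m" "\<exists>C. (\<forall>i\<le>m. C i \<in> F) \<and> (\<forall>i<m. C i \<subset> C (Suc i))" by blast
    then have "m \<noteq> Suc n" using none by blast
    have "e \<le> enat (Suc n)" using assms Sup_upper[OF e] by (simp add: chain_length_sup_def)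
    then show "e \<le> enat n" using m(1) \<open>m \<noteq> Suc n\<close> by simp
  qed
  then show False using assms by (simp add: chain_length_sup_def)
qed

lemma chain_length_sup_infinite:
  assumes "\<And>n. \<exists>C. (\<forall>i\<le>n. C i \<in> F) \<and> (\<forall>i<n. C i \<subset> C (Suc i))"
  shows "chain_length_sup F = \<infinity>"
proof (rule ccontr)
  assume "chain_length_sup F \<noteq> \<infinity>"
  then obtain K where K: "chain_length_sup F = enat K" by auto
  have "enat (Suc K) \<le> chain_length_sup F"
    unfolding chain_length_sup_def by (rule Sup_upper) (use assms[of "Suc K"] in blast)
  then show False by (simp add: K)
qed

context cring
begin

lemma ring_as_module_simps [simp]:
  "carrier (ring_as_module R) = carrier R" "a \<odot>\<^bsub>ring_as_module R\<^esub> b = a \<otimes> b"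
  "\<zero>\<^bsub>ring_as_module R\<^esub> = \<zero>" "a \<oplus>\<^bsub>ring_as_module R\<^esub> b = a \<oplus> b"
  by (simp_all add: ring_as_module_def)

lemma module_ring_as_module: "module R (ring_as_module R)"
proof (rule moduleI)
  show "abelian_group (ring_as_module R)"
    by (rule abelian_groupI) (auto simp: a_ac intro: bexI[of _ "\<ominus> _"] l_neg)
qed (auto simp: is_cring l_distr r_distr m_assoc)

lemma submodule_iff_ideal: "submodule N R (ring_as_module R) \<longleftrightarrow> ideal N R"
proof
  interpret M: module R "ring_as_module R" by (rule module_ring_as_module)
  {
    assume "submodule N R (ring_as_module R)"
    note N = M.submoduleE[OF this]
    show "ideal N R" using N by (intro idealI_commutative) auto
  next
    assume "ideal N R"
    then interpret N: ideal N R .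
    show "submodule N R (ring_as_module R)"
    proof (rule M.submoduleI)
      fix a assume a: "a \<in> N"
      have "\<ominus>\<^bsub>ring_as_module R\<^esub> a = \<ominus> a"
        using N.Icarr[OF a] M.minus_equality[of "\<ominus> a" a] by (simp add: l_neg)
      then show "\<ominus>\<^bsub>ring_as_module R\<^esub> a \<in> N" using a by simp
    qed (auto simp: N.Icarr intro: N.I_l_closed)
  }
qed

lemma submodule_span_eq_genideal: "submodule_span R (ring_as_module R) A = Idl A"
  by (simp add: submodule_span_def genideal_def submodule_iff_ideal)

lemma ideal_mult_eq_genideal:
  assumes "set xs \<subseteq> carrier R"
  shows "ideal_mult R (ring_as_module R) xs = Idl (set xs)"
proof -
  let ?X = "{x \<otimes> v | x v. x \<in> set xs \<and> v \<in> carrier R}"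
  have X: "?X \<subseteq> carrier R" using assms by auto
  interpret I: ideal "Idl (set xs)" R by (rule genideal_ideal[OF assms])
  have "Idl ?X \<subseteq> Idl (set xs)"
    by (rule genideal_minimal[OF I.is_ideal])
       (use genideal_self[OF assms] I.I_r_closed in blast)
  moreover have "set xs \<subseteq> ?X" using assms by (force intro: exI[of _ "\<one>"])
  then have "Idl (set xs) \<subseteq> Idl ?X"
    using genideal_self[OF X] by (intro genideal_minimal genideal_ideal[OF X]) blast
  ultimately show ?thesis
    by (simp add: ideal_mult_def submodule_span_eq_genideal)
qed

lemma noetherian_ring_as_module:
  assumes "noetherian_ring R"
  shows "noetherian_module R (ring_as_module R)"
  using noetherian_ring.finetely_gen[OF assms] module_ring_as_module
  by (simp add: noetherian_module_def submodule_iff_ideal submodule_span_eq_genideal)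

lemma genideal_empty: "Idl {} = {\<zero>}"
  using genideal_minimal[OF zeroideal, of "{}"] additive_subgroup.zero_closed[OF ideal.axioms(1)[OF genideal_ideal[of "{}"]]]
  by auto

lemma genideal_pair_elem:
  assumes "x \<in> carrier R" "y \<in> carrier R" "z \<in> Idl {x, y}"
  shows "\<exists>a\<in>carrier R. \<exists>b\<in>carrier R. z = x \<otimes> a \<oplus> y \<otimes> b"
proof -
  let ?I = "{x \<otimes> a \<oplus> y \<otimes> b | a b. a \<in> carrier R \<and> b \<in> carrier R}"
  have "ideal ?I R"
  proof (rule idealI_commutative)
    fix u v assume "u \<in> ?I" "v \<in> ?I"
    then obtain a b c d where "u = x \<otimes> a \<oplus> y \<otimes> b" "v = x \<otimes> c \<oplus> y \<otimes> d"
      "a \<in> carrier R" "b \<in> carrier R" "c \<in> carrier R" "d \<in> carrier R" by blast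
    then have "u \<oplus> v = x \<otimes> (a \<oplus> c) \<oplus> y \<otimes> (b \<oplus> d) \<and> a \<oplus> c \<in> carrier R \<and> b \<oplus> d \<in> carrier R"
      using assms by (simp add: r_distr a_ac)
    then show "u \<oplus> v \<in> ?I" by blast
  next
    fix u v assume "u \<in> ?I" "v \<in> carrier R"
    then obtain a b where "u = x \<otimes> a \<oplus> y \<otimes> b" "a \<in> carrier R" "b \<in> carrier R" by blast
    then have "v \<otimes> u = x \<otimes> (v \<otimes> a) \<oplus> y \<otimes> (v \<otimes> b) \<and> v \<otimes> a \<in> carrier R \<and> v \<otimes> b \<in> carrier R"
      using assms \<open>v \<in> carrier R\<close> by (simp add: r_distr m_ac)
    then show "v \<otimes> u \<in> ?I" by blast
  qed (use assms in auto)
  moreover have "x = x \<otimes> \<one> \<oplus> y \<otimes> \<zero>" "y = x \<otimes> \<zero> \<oplus> y \<otimes> \<one>" using assms by simp_all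
  then have "{x, y} \<subseteq> ?I" by blast
  ultimately have "Idl {x, y} \<subseteq> ?I" by (rule genideal_minimal)
  then show ?thesis using assms(3) by blast
qed

lemma genideal_singleton: "x \<in> carrier R \<Longrightarrow> Idl {x} = {x \<otimes> a | a. a \<in> carrier R}"
  unfolding cgenideal_eq_genideal[symmetric] cgenideal_def using m_comm by blast

end

text \<open>Localness is stated as invertibility outside \<open>\<mm>\<close>, the form in which it is used.\<close>
locale local_domain = domain R for R (structure) +
  fixes \<mm>
  assumes m_ideal: "ideal \<mm> R" and one_notin_m: "\<one> \<notin> \<mm>"
    and unit_outside_m: "z \<in> carrier R \<Longrightarrow> z \<notin> \<mm> \<Longrightarrow> \<exists>w\<in>carrier R. z \<otimes> w = \<one>"
begin

sublocale m: ideal \<mm> R by (rule m_ideal)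

lemma proper_ideal_subset_m:
  assumes "ideal I R" "I \<noteq> carrier R"
  shows "I \<subseteq> \<mm>"
proof (rule ccontr)
  interpret I: ideal I R by fact
  assume "\<not> I \<subseteq> \<mm>"
  then obtain z where z: "z \<in> I" "z \<notin> \<mm>" by blast
  then obtain w where "w \<in> carrier R" "z \<otimes> w = \<one>" using unit_outside_m I.Icarr by blast
  then have "\<one> \<in> I" using I.I_r_closed[OF z(1)] by metis
  then show False using assms(2) I.one_imp_carrier by simp
qed

lemma local_ring:
  assumes "noetherian_ring R" shows "noetherian_local_ring R \<mm>"
  unfolding noetherian_local_ring_def
proof (intro conjI allI impI)
  have proper: "\<mm> \<noteq> carrier R" using one_notin_m by blast
  show "maximalideal \<mm> R"
    using proper_ideal_subset_m proper by (intro maximalidealI m_ideal) auto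
  fix \<nn> assume "maximalideal \<nn> R"
  then interpret n: maximalideal \<nn> R .
  show "\<nn> = \<mm>"
    using n.I_maximal[OF m_ideal] proper_ideal_subset_m[OF n.is_ideal] n.I_notcarr proper m.a_subset
    by blast
qed (use assms is_cring in auto)

text \<open>
  The ideals \<open>N + (z\<^sup>n)\<close> descend, so two consecutive ones agree. Then \<open>z\<^sup>n (1 - a z) \<in> N\<close> for some \<open>a\<close>,
  and \<open>1 - a z\<close> is a unit because \<open>z \<in> \<mm>\<close>.
\<close>
lemma power_in_cofinite_ideal:
  assumes N: "ideal N R" and len: "quotient_length R (ring_as_module R) N < \<infinity>" and z: "z \<in> \<mm>"
  shows "\<exists>n::nat. z [^] n \<in> N"
proof -
  interpret N: ideal N R by fact
  have zc [simp]: "z \<in> carrier R" using z m.Icarr by blast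
  define I where "I = (\<lambda>n::nat. {v \<oplus> a \<otimes> z [^] n | v a. v \<in> N \<and> a \<in> carrier R})"
  have idl: "ideal (I n) R" for n
  proof (rule idealI_commutative)
    show "I n \<subseteq> carrier R" using N.Icarr by (auto simp: I_def)
    show "I n \<noteq> {}"
      unfolding I_def using additive_subgroup.zero_closed[OF N.is_additive_subgroup] by blast
    fix u w assume "u \<in> I n" "w \<in> I n"
    then obtain v a v' a' where *: "u = v \<oplus> a \<otimes> z [^] n" "w = v' \<oplus> a' \<otimes> z [^] n"
      "v \<in> N" "v' \<in> N" "a \<in> carrier R" "a' \<in> carrier R" by (auto simp: I_def)
    then have "u \<oplus> w = (v \<oplus> v') \<oplus> (a \<oplus> a') \<otimes> z [^] n"
      using N.Icarr by (simp add: l_distr a_ac)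
    then show "u \<oplus> w \<in> I n" using * N.a_closed unfolding I_def by blast
  next
    fix u w assume "u \<in> I n" and w: "w \<in> carrier R"
    then obtain v a where *: "u = v \<oplus> a \<otimes> z [^] n" "v \<in> N" "a \<in> carrier R" by (auto simp: I_def)
    then have "w \<otimes> u = w \<otimes> v \<oplus> (w \<otimes> a) \<otimes> z [^] n"
      using N.Icarr w by (simp add: r_distr m_assoc)
    then show "w \<otimes> u \<in> I n" using * w N.I_l_closed unfolding I_def by blast
  qed
  have N_sub: "N \<subseteq> I n" for n
  proof
    fix v assume "v \<in> N"
    moreover from this have "v = v \<oplus> \<zero> \<otimes> z [^] n" using N.Icarr by simp
    ultimately show "v \<in> I n" unfolding I_def by blast
  qed
  have dec: "I (Suc n) \<subseteq> I n" for n
  proof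
    fix u assume "u \<in> I (Suc n)"
    then obtain v a where *: "u = v \<oplus> a \<otimes> z [^] Suc n" "v \<in> N" "a \<in> carrier R" unfolding I_def by blast
    then have "u = v \<oplus> (a \<otimes> z) \<otimes> z [^] n" by (simp add: m_ac)
    moreover have "a \<otimes> z \<in> carrier R" using *(3) by simp
    ultimately show "u \<in> I n" using *(2) unfolding I_def by blast
  qed
  have "\<exists>n. I (Suc n) = I n"
  proof (rule ccontr)
    assume "\<not> ?thesis"
    then have strict: "I (Suc n) \<subset> I n" for n using dec by blast
    have "chain_length_sup {L. submodule L R (ring_as_module R) \<and> N \<subseteq> L} = \<infinity>"
    proof (rule chain_length_sup_infinite)
      fix n
      have "I (n - i) \<subset> I (n - Suc i)" if "i < n" for i
        using strict[of "n - Suc i"] that by (simp add: Suc_diff_Suc)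
      then show "\<exists>C. (\<forall>i\<le>n. C i \<in> {L. submodule L R (ring_as_module R) \<and> N \<subseteq> L}) \<and>
          (\<forall>i<n. C i \<subset> C (Suc i))"
        using idl N_sub by (intro exI[of _ "\<lambda>i. I (n - i)"]) (simp add: submodule_iff_ideal)
    qed
    then show False using len by (simp add: quotient_length_def)
  qed
  then obtain n where n: "I (Suc n) = I n" by blast
  have "z [^] n = \<zero> \<oplus> \<one> \<otimes> z [^] n" by simp
  then have "z [^] n \<in> I n"
    using additive_subgroup.zero_closed[OF N.is_additive_subgroup] unfolding I_def by blast
  then have "z [^] n \<in> I (Suc n)" using n by simp
  then obtain v a where *: "z [^] n = v \<oplus> a \<otimes> z [^] Suc n" "v \<in> N" "a \<in> carrier R"
    unfolding I_def by blast
  have vc: "v \<in> carrier R" using * N.Icarr by blast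
  have az: "a \<otimes> z \<in> \<mm>" using m.I_l_closed[OF z] * by simp
  have "\<one> \<ominus> a \<otimes> z \<notin> \<mm>"
  proof
    assume "\<one> \<ominus> a \<otimes> z \<in> \<mm>"
    then have "(\<one> \<ominus> a \<otimes> z) \<oplus> a \<otimes> z \<in> \<mm>" using az by (rule m.a_closed)
    moreover have "(\<one> \<ominus> a \<otimes> z) \<oplus> a \<otimes> z = \<one>" using * by (simp add: a_minus_def a_assoc l_neg)
    ultimately show False using one_notin_m by simp
  qed
  then obtain w where w: "w \<in> carrier R" "(\<one> \<ominus> a \<otimes> z) \<otimes> w = \<one>"
    using unit_outside_m * by (meson m_closed minus_closed one_closed zc)
  have "z [^] n \<otimes> (\<one> \<ominus> a \<otimes> z) = z [^] n \<ominus> a \<otimes> z [^] Suc n"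
    using *(3) by (simp add: a_minus_def r_distr r_minus m_ac)
  also have "\<dots> = (v \<oplus> a \<otimes> z [^] Suc n) \<ominus> a \<otimes> z [^] Suc n"
    using *(1) by simp
  also have "\<dots> = v" using *(3) vc by (simp add: a_minus_def a_assoc r_neg)
  finally have eq: "z [^] n \<otimes> (\<one> \<ominus> a \<otimes> z) = v" .
  have "z [^] n = z [^] n \<otimes> ((\<one> \<ominus> a \<otimes> z) \<otimes> w)" using w by simp
  also have "\<dots> = (z [^] n \<otimes> (\<one> \<ominus> a \<otimes> z)) \<otimes> w" using w *(3) by (simp add: m_assoc)
  also have "\<dots> = v \<otimes> w" by (simp only: eq)
  also have "\<dots> \<in> N" using N.I_r_closed *(2) w by blast
  finally show ?thesis by blast
qed

text \<open>
  A regular sequence of length two in a domain, up to properness of the ideal \<open>(p, q)\<close>: since \<open>p\<close> is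
  nonzero it is a nonzerodivisor, and \<open>q\<close> is a nonzerodivisor modulo \<open>p\<close>.
\<close>
definition regular_pair :: "'a \<Rightarrow> 'a \<Rightarrow> bool" where
  "regular_pair p q \<longleftrightarrow> p \<in> carrier R \<and> q \<in> carrier R \<and> p \<noteq> \<zero> \<and>
    (\<forall>a\<in>carrier R. \<forall>c\<in>carrier R. q \<otimes> a = p \<otimes> c \<longrightarrow> (\<exists>a'\<in>carrier R. a = p \<otimes> a'))"

text \<open>
  A regular sequence of length two cannot lie in a principal ideal \<open>(y)\<close> with \<open>y \<in> \<mm>\<close>: from \<open>p = y b\<close>
  and \<open>q = y c\<close> follows \<open>q b = p c\<close>, so \<open>p\<close> divides \<open>b\<close> and \<open>y\<close> would be a unit. This replaces an
  appeal to Krull's principal ideal theorem.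
\<close>
lemma regular_pair_first_nonzero:
  assumes reg: "regular_pair p q" and x: "x \<in> carrier R" and y: "y \<in> \<mm>"
    and p: "p \<in> Idl {x, y}" and q: "q \<in> Idl {x, y}"
  shows "x \<noteq> \<zero>"
proof
  assume "x = \<zero>"
  have yc: "y \<in> carrier R" using y m.Icarr by blast
  obtain b c where b: "b \<in> carrier R" "p = y \<otimes> b" and c: "c \<in> carrier R" "q = y \<otimes> c"
    using genideal_pair_elem[OF x yc p] genideal_pair_elem[OF x yc q] yc \<open>x = \<zero>\<close> by auto
  have "q \<otimes> b = p \<otimes> c" using b c yc by (simp add: m_ac)
  then obtain d where d: "d \<in> carrier R" "b = p \<otimes> d"
    using reg b c unfolding regular_pair_def by blast
  have pc: "p \<in> carrier R" "p \<noteq> \<zero>" using reg by (auto simp: regular_pair_def)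
  have "p \<otimes> \<one> = p \<otimes> (y \<otimes> d)" using b(2) d pc yc by (simp add: m_ac)
  then have "\<one> = y \<otimes> d" using pc d yc m_lcancel[of p \<one> "y \<otimes> d"] by simp
  then show False using m.I_r_closed[OF y d(1)] one_notin_m by simp
qed

text \<open>
  Everything in \<open>(x, y)\<close> multiplies \<open>v\<close> into \<open>(x)\<close>, in particular \<open>p v = x c\<close> and \<open>q v = x d\<close>. Cancelling
  \<open>x\<close> from \<open>x q c = q p v = x p d\<close> leaves \<open>q c = p d\<close>, so \<open>p\<close> divides \<open>c\<close>.
\<close>
lemma regular_pair_second_nonzerodivisor:
  assumes reg: "regular_pair p q" and x: "x \<in> carrier R" "x \<noteq> \<zero>" and y: "y \<in> carrier R"
    and p: "p \<in> Idl {x, y}" and q: "q \<in> Idl {x, y}"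
    and v: "v \<in> carrier R" "y \<otimes> v \<in> Idl {x}"
  shows "v \<in> Idl {x}"
proof -
  obtain u where u: "u \<in> carrier R" "y \<otimes> v = x \<otimes> u" using v x genideal_singleton by auto
  have mult_v: "\<exists>c\<in>carrier R. z \<otimes> v = x \<otimes> c" if z: "z \<in> Idl {x, y}" for z
  proof -
    obtain a b where ab: "a \<in> carrier R" "b \<in> carrier R" "z = x \<otimes> a \<oplus> y \<otimes> b"
      using genideal_pair_elem[OF x(1) y z] by blast
    have "z \<otimes> v = x \<otimes> (a \<otimes> v) \<oplus> (y \<otimes> v) \<otimes> b" using ab x y v by (simp add: l_distr r_distr m_ac)
    also have "\<dots> = x \<otimes> (a \<otimes> v \<oplus> u \<otimes> b)" unfolding u(2) using ab x y v u by (simp add: r_distr m_ac)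
    finally show ?thesis using ab u v by blast
  qed
  obtain c d where c: "c \<in> carrier R" "p \<otimes> v = x \<otimes> c" and d: "d \<in> carrier R" "q \<otimes> v = x \<otimes> d"
    using mult_v p q by blast
  have pq: "p \<in> carrier R" "q \<in> carrier R" "p \<noteq> \<zero>" using reg by (auto simp: regular_pair_def)
  have "x \<otimes> (q \<otimes> c) = q \<otimes> (p \<otimes> v)" unfolding c(2) using c x pq by (simp add: m_ac)
  also have "\<dots> = p \<otimes> (q \<otimes> v)" using v pq by (simp add: m_ac)
  also have "\<dots> = x \<otimes> (p \<otimes> d)" unfolding d(2) using d x pq by (simp add: m_ac)
  finally have "q \<otimes> c = p \<otimes> d" using m_lcancel[of x "q \<otimes> c" "p \<otimes> d"] x pq c d by simp
  then obtain e where e: "e \<in> carrier R" "c = p \<otimes> e" using reg c d unfolding regular_pair_def by blast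
  have "p \<otimes> v = p \<otimes> (x \<otimes> e)" using c(2) e pq x by (simp add: m_ac)
  then have "v = x \<otimes> e" using m_lcancel[of p v "x \<otimes> e"] pq v x e by simp
  then show ?thesis using x e genideal_singleton by auto
qed

lemma weak_sequence_single:
  assumes "x \<in> carrier R" "x \<noteq> \<zero>"
  shows "weak_sequence R \<mm> (ring_as_module R) [x]"
proof -
  have "v = \<zero>" if "v \<in> carrier R" "x \<otimes> v = \<zero>" for v
    using integral[of x v] assms that by blast
  then have "r \<otimes> v = \<zero>" if "v \<in> carrier R" "x \<otimes> v = \<zero>" "r \<in> \<mm>" for v r
    using that(1,2) m.Icarr[OF that(3)] by (metis r_null)
  then show ?thesis
    by (simp add: weak_sequence_def ideal_mult_eq_genideal genideal_empty)
qed

lemma weak_sequence_pair: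
  assumes x: "x \<in> carrier R" "x \<noteq> \<zero>" and y: "y \<in> carrier R"
    and nzd: "\<And>v. v \<in> carrier R \<Longrightarrow> y \<otimes> v \<in> Idl {x} \<Longrightarrow> v \<in> Idl {x}"
  shows "weak_sequence R \<mm> (ring_as_module R) [x, y]"
  unfolding weak_sequence_def
proof (intro allI impI ballI)
  fix i v r
  assume i: "i < length [x, y]" and v: "v \<in> carrier (ring_as_module R)" and r: "r \<in> \<mm>"
    and xv: "[x, y] ! i \<odot>\<^bsub>ring_as_module R\<^esub> v \<in> ideal_mult R (ring_as_module R) (take i [x, y])"
  interpret I: ideal "Idl {x}" R using x by (intro genideal_ideal) simp
  have rc: "r \<in> carrier R" using r m.Icarr by blast
  have vc: "v \<in> carrier R" using v by simp
  consider "i = 0" | "i = 1" using i by fastforce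
  then show "r \<odot>\<^bsub>ring_as_module R\<^esub> v \<in> ideal_mult R (ring_as_module R) (take i [x, y])"
  proof cases
    case 1
    then have "x \<otimes> v = \<zero>" using xv by (simp add: ideal_mult_eq_genideal genideal_empty)
    then have "v = \<zero>" using integral[of x v] x vc by simp
    then show ?thesis using 1 rc by (simp add: ideal_mult_eq_genideal genideal_empty)
  next
    case 2
    then have "v \<in> Idl {x}" using xv x vc nzd by (simp add: ideal_mult_eq_genideal)
    then show ?thesis using 2 x rc I.I_l_closed by (simp add: ideal_mult_eq_genideal)
  qed
qed

text \<open>
  The number of parameters equals the dimension, so \<open>dim\<close> leaves sequences of length at most two, and a
  chain of primes of that length exists. With one parameter it suffices that the ring is not a field.
  Powers occur in \<open>reg\<close> because only powers of \<open>p\<close> and \<open>q\<close> lie in the ideal of the parameters.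
\<close>
lemma buchsbaum_of_regular_pair:
  assumes noeth: "noetherian_ring R"
    and dim: "\<And>P0 P1 P2 P3. primeideal P0 R \<Longrightarrow> primeideal P1 R \<Longrightarrow> primeideal P2 R \<Longrightarrow>
      primeideal P3 R \<Longrightarrow> \<not> (P0 \<subset> P1 \<and> P1 \<subset> P2 \<and> P2 \<subset> P3)"
    and reg: "\<And>P0 P1 P2. primeideal P0 R \<Longrightarrow> primeideal P1 R \<Longrightarrow> primeideal P2 R \<Longrightarrow>
      P0 \<subset> P1 \<Longrightarrow> P1 \<subset> P2 \<Longrightarrow>
      \<exists>p\<in>\<mm>. \<exists>q\<in>\<mm>. \<forall>(m::nat) (n::nat). regular_pair (p [^] m) (q [^] n)"
  shows "buchsbaum_module R (ring_as_module R)"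
  unfolding buchsbaum_module_def
proof (intro exI conjI allI impI)
  show "noetherian_local_ring R \<mm>" by (rule local_ring[OF noeth])
  show "noetherian_module R (ring_as_module R)" by (rule noetherian_ring_as_module[OF noeth])
  fix xs assume "system_of_parameters R \<mm> (ring_as_module R) xs"
  then have xs: "set xs \<subseteq> \<mm>" and len: "enat (length xs) = module_dim R (ring_as_module R)"
    and fin: "quotient_length R (ring_as_module R) (ideal_mult R (ring_as_module R) xs) < \<infinity>"
    by (auto simp: system_of_parameters_def)
  have xsc: "set xs \<subseteq> carrier R" using xs m.Icarr by blast
  have power: "\<exists>n::nat. z [^] n \<in> Idl (set xs)" if "z \<in> \<mm>" for z
    using power_in_cofinite_ideal[OF genideal_ideal[OF xsc] _ that] fin
    by (simp add: ideal_mult_eq_genideal[OF xsc])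
  show "weak_sequence R \<mm> (ring_as_module R) xs"
  proof (cases "length xs")
    case 0
    then show ?thesis by (simp add: weak_sequence_def)
  next
    case (Suc n)
    then obtain C where C: "\<And>i. i \<le> Suc n \<Longrightarrow> primeideal (C i) R" "\<And>i. i < Suc n \<Longrightarrow> C i \<subset> C (Suc i)"
      using chain_length_sup_attained[of _ n] len unfolding module_dim_def by (metis (no_types, lifting) mem_Collect_eq)
    consider "n = 0" | "n = 1" | "n \<ge> 2" by linarith
    then show ?thesis
    proof cases
      case 1
      then obtain x where x: "xs = [x]" using Suc by (auto simp: length_Suc_conv)
      have "x \<noteq> \<zero>"
      proof
        assume "x = \<zero>"
        interpret C1: primeideal "C 1" R using C(1)[of 1] 1 by simp
        obtain z where z: "z \<in> C 1" "z \<notin> C 0" using C(2)[of 0] 1 by auto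
        have "z \<in> \<mm>" using proper_ideal_subset_m[OF C1.is_ideal] C1.I_notcarr z by blast
        then obtain m where "z [^] (m::nat) \<in> Idl {\<zero>}" using power x \<open>x = \<zero>\<close> by auto
        then have "z [^] m = \<zero>" by (simp add: genideal_zero)
        then have "z = \<zero>" using C1.Icarr[OF z(1)]
          by (induction m) (auto dest: integral)
        interpret C0: primeideal "C 0" R using C(1)[of 0] by simp
        show False using z(2) \<open>z = \<zero>\<close> additive_subgroup.zero_closed[OF C0.is_additive_subgroup] by simp
      qed
      then show ?thesis using weak_sequence_single x xsc by simp
    next
      case 2
      then obtain x y where xy: "xs = [x, y]" using Suc by (auto simp: length_Suc_conv)
      have c: "x \<in> carrier R" "y \<in> carrier R" "y \<in> \<mm>" using xy xs xsc by auto
      obtain p q where pq: "p \<in> \<mm>" "q \<in> \<mm>" "\<And>(m::nat) (n::nat). regular_pair (p [^] m) (q [^] n)"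
        using reg[of "C 0" "C 1" "C 2"] C(1)[of 0] C(1)[of 1] C(1)[of 2] C(2)[of 0] C(2)[of 1] 2
        by (auto simp: numeral_2_eq_2)
      obtain m n :: nat where mn: "p [^] m \<in> Idl {x, y}" "q [^] n \<in> Idl {x, y}"
        using power[OF pq(1)] power[OF pq(2)] xy by auto
      have "x \<noteq> \<zero>" by (rule regular_pair_first_nonzero[OF pq(3) c(1,3) mn])
      then show ?thesis
        unfolding xy using c regular_pair_second_nonzerodivisor[OF pq(3) c(1) _ c(2) mn]
        by (intro weak_sequence_pair)
    next
      case 3
      then have "\<not> (C 0 \<subset> C 1 \<and> C 1 \<subset> C 2 \<and> C 2 \<subset> C 3)" by (intro dim C) auto
      then show ?thesis using C(2)[of 0] C(2)[of 1] C(2)[of 2] 3 by (simp add: numeral_2_eq_2 numeral_3_eq_3)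
    qed
  qed
qed

end

section \<open>Semigroup rings of separated monoids are Buchsbaum\<close>

lemma (in domain_at_prime) local_domain_localization: "local_domain L max_ideal"
  by (intro local_domain.intro local_domain_axioms.intro L.domain_axioms max_ideal_ideal
      max_ideal_proper max_ideal_complement_unit) simp

context cm_plane_monoid
begin

text \<open>
  The monomials \<open>\<chi>\<^sup>l\<^sup>e\<close> have distinct exponents since \<open>e \<noteq> 0\<close>, so a nontrivial polynomial in \<open>\<chi>\<^sup>e\<close> is not
  zero in the ring.
\<close>
lemma axis_polynomial_in_third_prime:
  assumes "primeideal P0 R" "primeideal P1 R" "primeideal P2 R" "P0 \<subset> P1" "P1 \<subset> P2"
    and e: "e \<in> S" "e \<noteq> 0"
  shows "\<exists>p\<in>P2. p \<noteq> 0 \<and> keys p \<subseteq> ray e"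
proof -
  let ?x = "mon e (1::'k)"
  have power: "?x ^ l = mon (multiple l e) 1" for l
  proof (induction l)
    case (Suc l)
    then show ?case using multiple_add[of 1 l e] by (simp add: mult_single multiple_def)
  qed (simp add: multiple_def zero_prod_def[symmetric])
  obtain N c where c: "\<exists>l<N. c l \<noteq> (0::'k)" "(\<Sum>l<N. mon 0 (c l) * ?x ^ l) \<in> P2"
    using relation_in_third_prime[OF assms(1-5), of ?x] e by auto
  define p where "p = (\<Sum>l<N. mon (multiple l e) (c l))"
  have p_in: "p \<in> P2" using c(2) by (simp add: p_def power mult_single)
  have "keys p \<subseteq> ray e"
    unfolding p_def by (intro keys_sum_subset keys_mon_subset) blast
  moreover have "p \<noteq> 0"
  proof -
    obtain l where l: "l < N" "c l \<noteq> 0" using c(1) by blast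
    have "multiple i e = multiple l e \<longleftrightarrow> i = l" for i
      using e(2) by (cases e) (auto simp: multiple_def zero_prod_def)
    then have "lookup p (multiple l e) = c l"
      using l(1) by (simp add: p_def lookup_sum lookup_single when_def)
    then show ?thesis using l(2) by auto
  qed
  ultimately show ?thesis using p_in by blast
qed

lemma axis_polynomial_power:
  fixes p :: "(nat \<times> nat) \<Rightarrow>\<^sub>0 'k"
  assumes "keys p \<subseteq> ray e" shows "keys (p ^ n) \<subseteq> ray e"
  by (rule keys_power_subset[OF assms zero_in_ray ray_add])

text \<open>
  Chains of primes of the localization contract to chains in \<open>R\<close>, where the counting argument applies.
  The polynomials in \<open>X\<close> and \<open>Y\<close> found in the top prime of a chain lie in the maximal ideal, and
  their powers are again polynomials in the same variable, hence regular pairs.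
\<close>
lemma localization_buchsbaum:
  assumes "maximalideal \<mm> R"
  shows "buchsbaum_module (localization R \<mm>) (ring_as_module (localization R \<mm>))"
proof -
  interpret maximal: maximalideal \<mm> R by fact
  have prime: "primeideal \<mm> R" by (rule maximalideal_prime[OF assms])
  interpret loc: domain_at_prime R \<mm>
    using domain_axioms prime by (intro domain_at_prime.intro)
  interpret A: local_domain "loc.L" loc.max_ideal by (rule loc.local_domain_localization)
  interpret embed: ring_hom_cring R "loc.L" loc.embed by (rule loc.embed_hom)
  let ?contract = "\<lambda>Q. {r \<in> carrier R. loc.embed r \<in> Q}"
  show ?thesis
  proof (rule A.buchsbaum_of_regular_pair)
    show "noetherian_ring loc.L" by (rule loc.localization_noetherian[OF R_noetherian])
  next
    fix P0 P1 P2 P3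
    assume P: "primeideal P0 loc.L" "primeideal P1 loc.L" "primeideal P2 loc.L" "primeideal P3 loc.L"
    show "\<not> (P0 \<subset> P1 \<and> P1 \<subset> P2 \<and> P2 \<subset> P3)"
      using no_chain_of_four_primes[OF P[THEN loc.contract_prime]]
        loc.contract_strict[OF P(1,2)] loc.contract_strict[OF P(2,3)] loc.contract_strict[OF P(3,4)]
      by blast
  next
    fix P0 P1 P2
    assume P: "primeideal P0 loc.L" "primeideal P1 loc.L" "primeideal P2 loc.L"
      and chain: "P0 \<subset> P1" "P1 \<subset> P2"
    interpret P2: primeideal P2 loc.L by fact
    note chainR = loc.contract_strict[OF P(1,2) chain(1)] loc.contract_strict[OF P(2,3) chain(2)]
    obtain p where p: "p \<in> ?contract P2" "p \<noteq> 0" "keys p \<subseteq> ray e1"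
      using axis_polynomial_in_third_prime[OF P[THEN loc.contract_prime] chainR e1_in e1_nonzero] by blast
    obtain q where q: "q \<in> ?contract P2" "q \<noteq> 0" "keys q \<subseteq> ray e2"
      using axis_polynomial_in_third_prime[OF P[THEN loc.contract_prime] chainR e2_in e2_nonzero] by blast
    have pqR: "p \<in> carrier R" "q \<in> carrier R" using p q by auto
    have P2_sub: "P2 \<subseteq> loc.max_ideal"
      using A.proper_ideal_subset_m[OF P2.is_ideal] P2.I_notcarr by blast
    have "A.regular_pair (loc.embed p [^]\<^bsub>loc.L\<^esub> m) (loc.embed q [^]\<^bsub>loc.L\<^esub> n)" for m n :: nat
    proof -
      have pm: "loc.embed p [^]\<^bsub>loc.L\<^esub> m = loc.embed (p ^ m)"
        using embed.ring.hom_nat_pow[OF pqR(1), of m] by (simp only: nat_pow_eq)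
      have qn: "loc.embed q [^]\<^bsub>loc.L\<^esub> n = loc.embed (q ^ n)"
        using embed.ring.hom_nat_pow[OF pqR(2), of n] by (simp only: nat_pow_eq)
      have pow: "p ^ m \<in> carrier R" "q ^ n \<in> carrier R"
        using pqR by (simp_all only: R_simps(1) keys_power_in)
      have reg: "\<exists>a'\<in>carrier R. a = p ^ m \<otimes> a'"
        if "a \<in> carrier R" "c \<in> carrier R" "q ^ n \<otimes> a = p ^ m \<otimes> c" for a c
        using axis_polynomials_regular[OF axis_polynomial_power[OF p(3)] _ axis_polynomial_power[OF q(3)] _ ,
            of m n a c] that p(2) q(2) by auto
      show ?thesis
        unfolding A.regular_pair_def pm qn
      proof (intro conjI ballI impI)
        show "loc.embed (p ^ m) \<noteq> \<zero>\<^bsub>loc.L\<^esub>"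
          using loc.frac_eq_zero_iff[of "p ^ m" \<one>] pow loc.one_valid p(2) by simp
        fix a c assume "a \<in> carrier loc.L" "c \<in> carrier loc.L"
          "loc.embed (q ^ n) \<otimes>\<^bsub>loc.L\<^esub> a = loc.embed (p ^ m) \<otimes>\<^bsub>loc.L\<^esub> c"
        then show "\<exists>a'\<in>carrier loc.L. a = loc.embed (p ^ m) \<otimes>\<^bsub>loc.L\<^esub> a'"
          using loc.embed_regular_pair[OF pow, of a c] reg by blast
      qed (use pow loc.embed_closed in blast)+
    qed
    then show "\<exists>p\<in>loc.max_ideal. \<exists>q\<in>loc.max_ideal. \<forall>(m::nat) (n::nat).
        A.regular_pair (p [^]\<^bsub>loc.L\<^esub> m) (q [^]\<^bsub>loc.L\<^esub> n)"
      using p q P2_sub by blast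
  qed
qed

lemma buchsbaum_R: "buchsbaum_ring R"
  unfolding buchsbaum_ring_def using is_cring R_noetherian localization_buchsbaum by blast

end

section \<open>Modular inequalities in the plane\<close>

text \<open>Remainders are subadditive: \<open>(m + n) mod b \<le> m mod b + n mod b\<close>.\<close>
lemma halfplane_monoid_closed:
  fixes f g :: "nat \<times> nat \<Rightarrow> int"
  assumes add: "\<And>u v. f (u + v) = f u + f v" "\<And>u v. g (u + v) = g u + g v"
    and "f u mod b \<le> g u" "f v mod b \<le> g v" "b > 0"
  shows "f (u + v) mod b \<le> g (u + v)"
proof -
  have "f (u + v) mod b = (f u mod b + f v mod b) mod b" by (simp add: add mod_add_eq)
  also have "\<dots> \<le> f u mod b + f v mod b" using \<open>b > 0\<close> by (intro zmod_le_nonneg_dividend) simp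
  finally show ?thesis using assms(3,4) by (simp add: add)
qed

text \<open>Exchanging the coordinates reduces the case \<open>g2 > 0 \<ge> g1\<close> to the case \<open>g1 > 0 \<ge> g2\<close>.\<close>
lemma cm_plane_monoid_swap:
  assumes "cm_plane_monoid S (semigroup_ring S :: ((nat \<times> nat) \<Rightarrow>\<^sub>0 'k::field) ring) e1 e2"
  shows "cm_plane_monoid (prod.swap ` S) (semigroup_ring (prod.swap ` S) :: ((nat \<times> nat) \<Rightarrow>\<^sub>0 'k) ring)
    (prod.swap e1) (prod.swap e2)"
proof -
  interpret cm_plane_monoid S "semigroup_ring S :: ((nat \<times> nat) \<Rightarrow>\<^sub>0 'k) ring" e1 e2 by fact
  have swap_add: "prod.swap u + prod.swap v = prod.swap (u + v)" for u v :: "nat \<times> nat"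
    by (simp add: prod_eq_iff)
  have swap_ray: "ray (prod.swap e) = prod.swap ` ray e" for e
    by (simp add: image_image multiple_def)
  have swap_multiple: "multiple i (prod.swap e) = prod.swap (multiple i e)" for i e
    by (simp add: multiple_def)
  show ?thesis
  proof
    show "0 \<in> prod.swap ` S" using zero_in by (force simp: zero_prod_def)
    show "u + v \<in> prod.swap ` S" if "u \<in> prod.swap ` S" "v \<in> prod.swap ` S" for u v
      using that add_in by (auto simp: swap_add simp del: swap_simp)
    show "\<exists>t\<in>prod.swap ` S. u = t + a"
      if mem: "u \<in> prod.swap ` S" "w \<in> prod.swap ` S" "a \<in> ray (prod.swap e1)" "c \<in> ray (prod.swap e2)"
        and eq: "u + c = w + a" for u w a c
    proof -
      obtain u' w' a' c' where *: "u = prod.swap u'" "w = prod.swap w'" "a = prod.swap a'" "c = prod.swap c'"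
        "u' \<in> S" "w' \<in> S" "a' \<in> ray e1" "c' \<in> ray e2"
        using mem unfolding swap_ray by blast
      then have "u' + c' = w' + a'" using eq by (simp add: prod_eq_iff)
      then obtain t where "t \<in> S" "u' = t + a'" using separation * by blast
      then show ?thesis using * by (auto simp: swap_add simp del: swap_simp)
    qed
    obtain F where "finite F" and F: "\<forall>v\<in>S. \<exists>r\<in>F. \<exists>i j. v = r + multiple i e1 + multiple j e2"
      using finite_over_rays by blast
    show "\<exists>F. finite F \<and> (\<forall>v\<in>prod.swap ` S. \<exists>r\<in>F. \<exists>i j.
        v = r + multiple i (prod.swap e1) + multiple j (prod.swap e2))"
    proof (intro exI[of _ "prod.swap ` F"] conjI ballI)
      fix v assume "v \<in> prod.swap ` S"
      then obtain v' where v': "v = prod.swap v'" "v' \<in> S" by blast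
      then obtain r i j where "r \<in> F" "v' = r + multiple i e1 + multiple j e2" using F by blast
      then show "\<exists>r\<in>prod.swap ` F. \<exists>i j. v = r + multiple i (prod.swap e1) + multiple j (prod.swap e2)"
        by (intro bexI[of _ "prod.swap r"] exI[of _ i] exI[of _ j])
           (simp_all add: v'(1) swap_multiple swap_add del: swap_simp)
    qed (use \<open>finite F\<close> in simp)
    show "prod.swap e1 \<noteq> 0" "prod.swap e2 \<noteq> 0"
      using e1_nonzero e2_nonzero by (auto simp: prod_eq_iff)
  qed (use e1_in e2_in in auto)
qed

text \<open>
  Both vectors lie in \<open>b \<int>\<^sup>2\<close>, so adding them keeps \<open>f\<close> modulo \<open>b\<close>, and \<open>g\<close> vanishes on the second one.
  For \<open>w = t + c\<close> with \<open>c\<close> on the second ray, the inequality for \<open>w\<close> therefore is the inequality for \<open>t\<close>.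
  It also implies \<open>g t \<ge> 0\<close>, which makes the first coordinate of \<open>t\<close> nonnegative because \<open>g2 \<le> 0 < g1\<close>.
\<close>
lemma modular_monoid_cm:
  fixes f1 f2 g1 g2 b :: int
  defines "f \<equiv> \<lambda>(x, y). f1 * int x + f2 * int y" and "g \<equiv> \<lambda>(x, y). g1 * int x + g2 * int y"
  assumes b: "b > 0" and g1: "g1 > 0" and g2: "g2 \<le> 0"
  defines "S \<equiv> {v. f v mod b \<le> g v}"
  shows "cm_plane_monoid S (semigroup_ring S :: ((nat \<times> nat) \<Rightarrow>\<^sub>0 'k::field) ring)
    (nat b, 0) (nat (- g2 * b), nat (g1 * b))"
proof -
  define n k h where "n = nat b" and "k = nat (- g2)" and "h = nat g1"
  have ints: "b = int n" "g2 = - int k" "g1 = int h" and pos: "n > 0" "h > 0"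
    using b g1 g2 by (simp_all add: n_def k_def h_def)
  have rays: "(nat b, 0) = (n, 0::nat)" "(nat (- g2 * b), nat (g1 * b)) = (k * n, h * n)"
    by (simp_all add: ints nat_mult_distrib)
  have mem: "(x, y) \<in> S \<longleftrightarrow> (f1 * int x + f2 * int y) mod b + int k * int y \<le> int h * int x" for x y
    by (auto simp: S_def f_def g_def ints)
  have cone: "k * y \<le> h * x" if "(x, y) \<in> S" for x y
  proof -
    have "int k * int y \<le> int h * int x"
      using that b pos_mod_sign[of b "f1 * int x + f2 * int y"] unfolding mem by linarith
    then show ?thesis by (metis of_nat_le_iff of_nat_mult)
  qed
  show ?thesis
    unfolding rays
  proof
    show "0 \<in> S" by (simp add: zero_prod_def mem)
    have "f (u + v) = f u + f v" "g (u + v) = g u + g v" for u v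
      by (cases u; cases v; simp add: f_def g_def algebra_simps)+
    then show "u + v \<in> S" if "u \<in> S" "v \<in> S" for u v
      using that halfplane_monoid_closed[of f g u b v] b by (simp add: S_def)
    show "(n, 0) \<in> S" by (simp add: mem ints)
    show "(n, 0) \<noteq> 0" "(k * n, h * n) \<noteq> 0" using pos by (simp_all add: zero_prod_def)
    show "(k * n, h * n) \<in> S"
    proof -
      have "(f1 * int (k * n) + f2 * int (h * n)) mod b = 0"
        by (simp add: ints distrib_left[symmetric] mult.assoc[symmetric] distrib_right[symmetric])
      then show ?thesis unfolding mem by (simp add: algebra_simps)
    qed
    show "\<exists>t\<in>S. u = t + a"
      if u: "u \<in> S" and w: "w \<in> S" and a: "a \<in> ray (n, 0)" and c: "c \<in> ray (k * n, h * n)" and eq: "u + c = w + a"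
      for u w a c
    proof -
      obtain x y where xy: "u = (x, y)" by (cases u)
      obtain x' y' where xy': "w = (x', y')" by (cases w)
      obtain i where i: "a = (i * n, 0)" using a by (auto simp: multiple_def)
      obtain j where j: "c = (j * (k * n), j * (h * n))" using c by (auto simp: multiple_def)
      have e: "x + j * k * n = x' + i * n" "y' = y + j * h * n" using eq by (simp_all add: xy xy' i j mult.assoc)
      have x': "int x' = int x + int j * int k * int n - int i * int n"
        using e(1) by (metis add_diff_cancel_right' of_nat_add of_nat_mult)
      have fw: "f1 * int x' + f2 * int y' = f1 * int x + f2 * int y + (f1 * (int j * int k - int i) + f2 * int j * int h) * b"
        and gw: "int h * int x' - int k * int y' = int h * (int x - int i * int n) - int k * int y"
        unfolding x' e(2) by (simp_all add: ints algebra_simps)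
      have fu: "(f1 * int x + f2 * int y) mod b \<le> int h * (int x - int i * int n) - int k * int y"
        using w gw unfolding xy' mem fw by simp
      moreover have "0 \<le> (f1 * int x + f2 * int y) mod b" using b by simp
      ultimately have "0 \<le> int h * (int x - int i * int n)"
        by (smt (verit) of_nat_0_le_iff mult_nonneg_nonneg)
      then have "int i * int n \<le> int x" using pos(2) by (simp add: zero_le_mult_iff)
      then have le: "i * n \<le> x" by (metis of_nat_le_iff of_nat_mult)
      then have ix: "int (x - i * n) = int x - int i * int n" by (simp add: of_nat_diff)
      have "f1 * int (x - i * n) + f2 * int y = f1 * int x + f2 * int y + (- f1 * int i) * b"
        unfolding ix by (simp add: ints algebra_simps)
      then have "(f1 * int (x - i * n) + f2 * int y) mod b = (f1 * int x + f2 * int y) mod b"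
        by (simp only: mod_mult_self1)
      then have "(x - i * n, y) \<in> S" unfolding mem ix using fu by simp
      moreover have "u = (x - i * n, y) + a" using le by (simp add: xy i)
      ultimately show ?thesis by blast
    qed
    show "\<exists>F. finite F \<and> (\<forall>v\<in>S. \<exists>r\<in>F. \<exists>i j. v = r + multiple i (n, 0) + multiple j (k * n, h * n))"
    proof (intro exI[of _ "{..<n} \<times> {..<h * n}"] conjI ballI)
      fix v assume "v \<in> S"
      then obtain x y where v: "v = (x, y)" and xy: "(x, y) \<in> S" by (cases v) auto
      define j where "j = y div (h * n)"
      have y: "y = y mod (h * n) + j * (h * n)" unfolding j_def by (rule mod_div_mult_eq[symmetric])
      have "h * (j * (k * n)) = k * (j * (h * n))" by simp
      also have "\<dots> \<le> k * y" by (intro mult_le_mono2) (simp add: j_def)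
      also have "\<dots> \<le> h * x" by (rule cone[OF xy])
      \<comment> \<open>As many copies of the second vector as the height allows can be removed inside the cone.\<close>
      finally have "j * (k * n) \<le> x" using pos by simp
      then have x: "x = (x - j * (k * n)) mod n + (x - j * (k * n)) div n * n + j * (k * n)"
        by simp
      have "v = ((x - j * (k * n)) mod n, y mod (h * n)) +
          multiple ((x - j * (k * n)) div n) (n, 0) + multiple j (k * n, h * n)"
        using x y by (simp add: v multiple_def)
      moreover have "((x - j * (k * n)) mod n, y mod (h * n)) \<in> {..<n} \<times> {..<h * n}" using pos by simp
      ultimately show "\<exists>r\<in>{..<n} \<times> {..<h * n}. \<exists>i j. v = r + multiple i (n, 0) + multiple j (k * n, h * n)"
        by blast
    qed simp
  qed simp
qed

theorem corollary17:
  fixes f g :: "nat \<times> nat \<Rightarrow> int" and f1 f2 g1 g2 b :: int and S :: "(nat \<times> nat) set"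
  assumes f: "f = (\<lambda>(x, y). f1 * int x + f2 * int y)"
    and g: "g = (\<lambda>(x, y). g1 * int x + g2 * int y)"
    and f_nonzero: "(f1, f2) \<noteq> (0, 0)"
    and g_nonzero: "(g1, g2) \<noteq> (0, 0)"
    and b_pos: "b > 0"
    and S: "S = {v. f v mod b \<le> g v}"
    and g_signs: "g1 * g2 \<le> 0"
    and g_not_both_nonpos: "\<not> (g1 \<le> 0 \<and> g2 \<le> 0)"
    and S_proper: "S \<noteq> UNIV"
  shows "buchsbaum_semigroup TYPE('k::field) S"
proof -
  have "\<exists>e1 e2. cm_plane_monoid S (semigroup_ring S :: ((nat \<times> nat) \<Rightarrow>\<^sub>0 'k) ring) e1 e2"
  proof (cases "g1 > 0")
    case True
    then have "g2 \<le> 0" using g_signs by (simp add: mult_le_0_iff)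
    then show ?thesis using modular_monoid_cm[OF b_pos True, of g2 f1 f2] unfolding S f g by blast
  next
    case False
    then have "g1 \<le> 0" "g2 > 0" using g_not_both_nonpos by auto
    define S' :: "(nat \<times> nat) set" where
      "S' = {v. (case v of (x, y) \<Rightarrow> f2 * int x + f1 * int y) mod b \<le> (case v of (x, y) \<Rightarrow> g2 * int x + g1 * int y)}"
    have mem: "(x, y) \<in> S \<longleftrightarrow> (y, x) \<in> S'" for x y
      by (simp add: S f g S'_def add.commute)
    have "S = prod.swap ` S'"
    proof (intro equalityI subsetI)
      fix v assume "v \<in> S"
      then have "v = prod.swap (prod.swap v)" "prod.swap v \<in> S'" using mem by (cases v; simp)+
      then show "v \<in> prod.swap ` S'" by (rule image_eqI)
    qed (use mem in auto)
    then show ?thesis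
      using cm_plane_monoid_swap[OF modular_monoid_cm[OF b_pos \<open>g2 > 0\<close> \<open>g1 \<le> 0\<close>, of f2 f1]]
      unfolding S'_def by blast
  qed
  then show ?thesis
    unfolding buchsbaum_semigroup_def using cm_plane_monoid.buchsbaum_R by blast
qed

end
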